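(* Let $r\ge1$, $\underline{x}=(x_1,\ldots,x_r)$, $\ell\ge1$, and for each $j=1,\ldots,\ell$ let $\mathcal{P}_j=\{P_{j1}(\underline{x}),\ldots,P_{js_j}(\underline{x})\}$ ($s_j\ge2$) be a family of nonzero coprime polynomials in $\mathbb{Z}[\underline{x}]$. Let $\mathcal{R}(\mathcal{P}_j)=\{\underline{n}\in\mathbb{Z}^r\mid\gcd(P_{j1}(\underline{n}),\ldots,P_{js_j}(\underline{n}))=1\}$ and $\mathcal{R}=\bigcap_{j=1}^\ell\mathcal{R}(\mathcal{P}_j)$. Let $\Pi=\mathcal{P}_1\cdots\mathcal{P}_\ell\subset\mathbb{Z}[\underline{x}]$ be the set of all products $A_1\cdots A_\ell$ with $A_j\in\mathcal{P}_j$ for $j=1,\ldots,\ell$, and let $\mathcal{R}(\Pi)$ be the set of $\underline{n}\in\mathbb{Z}^r$ such that the gcd of all $Q(\underline{n})$, $Q\in\Pi$, is $1$. Then: (a) The elements of $\Pi$ are nonzero coprime polynomials (in $\mathbb{Q}[\underline{x}]$). (b) $\mathcal{R}=\mathcal{R}(\Pi)$. (c) $\displaystyle\mu(\mathcal{R})=\prod_{p\text{ prime}}\left(1-\frac{c_p}{p^r}\right)$, where $c_p=\#\{\underline{n}\in(\mathbb{Z}/p\mathbb{Z})^r\mid Q(\underline{n})=0\pmod p \text{ for all } Q\in\Pi\}$. (d) For every prime $p$, we have $c_p=p^r$ if and only if for every $\underline{n}\in\mathbb{Z}^r$ there exists $j\in\{1,\ldots,\ell\}$ such that $p$ divides all values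 $P_{j1}(\underline{n}),\ldots,P_{js_j}(\underline{n})$.
   Context: A family of polynomials in $\mathbb{Z}[\underline{x}]$ is called coprime if no polynomial $D\in\mathbb{Q}[\underline{x}]$ with $\deg D>0$ divides all of them in $\mathbb{Q}[\underline{x}]$ (coprimality is within each family $\mathcal{P}_j$ collectively). The density of $\mathcal{S}\subset\mathbb{Z}^r$ is $\mu(\mathcal{S})=\lim_{B\to+\infty}\frac{\#(\mathcal{S}\cap\mathbb{B})}{\#\mathbb{B}}$ with $\mathbb{B}=\{0,1,\ldots,B-1\}^r$; (c) includes the existence of this limit. The infinite product is the limit of the partial products over primes $p\le M$ as $M\to+\infty$; it may be $0$. *)

theory Defs
  imports
    Complex_Main
    "HOL-Library.Poly_Mapping"
    "HOL-Library.FuncSet"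
    "HOL-Computational_Algebra.Primes"
begin

text \<open>
  Multivariate polynomials are finitely supported maps from monomials to coefficients, a monomial
  being a finitely supported map from variable indices to exponents. The type has infinitely many
  variables; the ring \<open>R[x\<^sub>1,\<dots>,x\<^sub>r]\<close> is the subset \<open>mpolys r\<close> of polynomials
  that involve only the variables with index in \<open>{..<r}\<close>.
\<close>

type_synonym 'a mpoly = "(nat \<Rightarrow>\<^sub>0 nat) \<Rightarrow>\<^sub>0 'a"

definition mpolys :: "nat \<Rightarrow> 'a::zero mpoly set" where
  "mpolys r = {p. \<forall>m \<in> Poly_Mapping.keys p. Poly_Mapping.keys m \<subseteq> {..<r}}"

definition mpoly_eval :: "'a::comm_semiring_1 mpoly \<Rightarrow> (nat \<Rightarrow> 'a) \<Rightarrow> 'a" where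
  "mpoly_eval p n = (\<Sum>m \<in> Poly_Mapping.keys p. Poly_Mapping.lookup p m *
      (\<Prod>i \<in> Poly_Mapping.keys m. n i ^ Poly_Mapping.lookup m i))"

text \<open>Total degree, with the convention that the zero polynomial has degree 0.\<close>

definition mpoly_degree :: "'a::zero mpoly \<Rightarrow> nat" where
  "mpoly_degree p = Max (insert 0
      ((\<lambda>m. \<Sum>i \<in> Poly_Mapping.keys m. Poly_Mapping.lookup m i) ` Poly_Mapping.keys p))"

definition rat_mpoly :: "int mpoly \<Rightarrow> rat mpoly" where
  "rat_mpoly p = Poly_Mapping.map rat_of_int p"

text \<open>
  Coprimality of a family is collective, not pairwise, and only excludes common divisors over the
  rationals of positive degree.
\<close>

definition coprime_family :: "nat \<Rightarrow> int mpoly set \<Rightarrow> bool" where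
  "coprime_family r F \<longleftrightarrow>
    \<not> (\<exists>D \<in> mpolys r. mpoly_degree D > 0 \<and>
         (\<forall>A \<in> F. \<exists>E \<in> mpolys r. rat_mpoly A = D * E))"

text \<open>
  Points of \<open>S\<^sup>r\<close> are extensional functions on \<open>{..<r}\<close>, so that distinct functions
  are distinct points and cardinalities are the expected ones.
\<close>

definition points :: "nat \<Rightarrow> 'a set \<Rightarrow> (nat \<Rightarrow> 'a) set" where
  "points r S = {..<r} \<rightarrow>\<^sub>E S"

definition coprime_values :: "nat \<Rightarrow> int mpoly set \<Rightarrow> (nat \<Rightarrow> int) set" where
  "coprime_values r F =
    {n \<in> points r UNIV. Gcd ((\<lambda>A. mpoly_eval A n) ` F) = 1}"

definition product_family :: "nat \<Rightarrow> (nat \<Rightarrow> int mpoly set) \<Rightarrow> int mpoly set" where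
  "product_family l F = {\<Prod>j = 1..l. A j | A. \<forall>j \<in> {1..l}. A j \<in> F j}"

definition has_density :: "nat \<Rightarrow> (nat \<Rightarrow> int) set \<Rightarrow> real \<Rightarrow> bool" where
  "has_density r S d \<longleftrightarrow>
    (\<lambda>B::nat. real (card (S \<inter> points r {0..<int B})) / real (card (points r {0..<int B})))
      \<longlonglongrightarrow> d"

text \<open>
  \<open>(\<int>/p\<int>)\<^sup>r\<close> is represented by the points with coordinates in \<open>{0..<p}\<close>;
  vanishing modulo \<open>p\<close> does not depend on the choice of representatives.
\<close>

definition num_common_zeros_mod :: "nat \<Rightarrow> int mpoly set \<Rightarrow> nat \<Rightarrow> nat" where
  "num_common_zeros_mod r F p =
    card {n \<in> points r {0..<int p}. \<forall>Q \<in> F. mpoly_eval Q n mod int p = 0}"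

end

theory Submission
  imports
    Defs
    "HOL-Computational_Algebra.Polynomial"
    "HOL-Number_Theory.Cong"
begin

text \<open>
  A prime divides all products of the families at a point iff it divides all members of one family
  there; this gives (b), (d), and reduces (c) to the single family \<open>\<Pi>\<close>. Its coprimality follows from
  unique factorisation in \<open>\<rat>[x]\<close>.

  For one coprime family \<open>F\<close>, the points at which no prime \<open>p \<le> M\<close> divides all values form a periodic
  set, whose density is the partial product by the Chinese remainder theorem. It remains to show that
  the points of \<open>{0..<B}\<^sup>r\<close> at which some prime \<open>p > M\<close> divides all values make up a proportion
  \<open>O(1/M + 1/B)\<close>. This is Ekedahl's sieve, by induction on \<open>r\<close>. The coefficients of the
  members of \<open>F\<close> with respect to the last variable are a coprime family in \<open>r - 1\<close> variables, so one may
  assume that some member of \<open>F\<close>, restricted to the fibre over \<open>x'\<close>, is nonzero modulo \<open>p\<close> and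
  has boundedly many roots. On the other hand, the ideal of \<open>F\<close> over \<open>\<rat>\<close> contains a nonzero \<open>h\<close> free of the
  last variable, so \<open>p\<close> divides \<open>h(x')\<close>: for \<open>p \<le> B\<close> this holds for a proportion \<open>O(1/p)\<close> of the \<open>x'\<close>,
  and for each \<open>x'\<close> with \<open>h(x') \<noteq> 0\<close> only boundedly many \<open>p > B\<close> occur.
\<close>

section \<open>Ring homomorphisms on multivariate polynomials\<close>

text \<open>The sum of \<open>1/p\<close> over the primes diverges, so one divisibility condition
  modulo \<open>p\<close> cannot control the large primes. Coprimality supplies two,
  \<open>h(x') = 0\<close> and a root condition in the last coordinate; for \<open>p \<le> B\<close>
  each costs a factor \<open>O(1/p)\<close>, and the sum of \<open>1/p^2\<close> over
  \<open>p > M\<close> is \<open>O(1/M)\<close>. For \<open>p > B\<close> a residue class meets a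
  side of the box in at most one point, so the bound for a single prime stops decaying in
  \<open>p\<close> and cannot be summed; there the point is fixed and its primes are counted
  instead. The constant in the error depends neither on \<open>M\<close> nor on \<open>B\<close>,
  which is why \<open>M\<close> can be fixed before \<open>B\<close> tends to infinity. With more
  than two members all pairwise resultants may vanish, so \<open>h\<close> is taken from the ideal
  generated by the whole family. The same lemma \<open>ideal_gcd\<close> yields the primality of
  irreducible polynomials and the existence of \<open>h\<close>. The type contains all variables at
  once, hence statements about a polynomial ring are relative to a set \<open>V\<close> of
  variables.\<close>

abbreviation Const :: "'a::zero \<Rightarrow> 'a mpoly" where
  "Const a \<equiv> Poly_Mapping.single 0 a"

definition Var :: "nat \<Rightarrow> 'a::zero_neq_one mpoly" where
  "Var i = Poly_Mapping.single (Poly_Mapping.single i 1) 1"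

definition monomial_value :: "(nat \<Rightarrow> 'b::comm_semiring_1) \<Rightarrow> (nat \<Rightarrow>\<^sub>0 nat) \<Rightarrow> 'b" where
  "monomial_value f m = (\<Prod>i\<in>Poly_Mapping.keys m. f i ^ Poly_Mapping.lookup m i)"

text \<open>Evaluation at a point, reading in one variable and extension of scalars are all
  instances, so multiplicativity is proved once. \<open>h\<close> is an arbitrary map;
  \<open>h 0 = 0\<close> enters as soon as the sum is extended beyond the support.\<close>

definition subst :: "('a::zero \<Rightarrow> 'b::comm_semiring_1) \<Rightarrow> (nat \<Rightarrow> 'b) \<Rightarrow> 'a mpoly \<Rightarrow> 'b" where
  "subst h f p = (\<Sum>m\<in>Poly_Mapping.keys p. h (Poly_Mapping.lookup p m) * monomial_value f m)"

definition ring_hom :: "('a::comm_semiring_1 \<Rightarrow> 'b::comm_semiring_1) \<Rightarrow> bool" where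
  "ring_hom h \<longleftrightarrow> h 0 = 0 \<and> h 1 = 1 \<and> (\<forall>a b. h (a + b) = h a + h b) \<and> (\<forall>a b. h (a * b) = h a * h b)"

lemma ring_hom_0: "ring_hom h \<Longrightarrow> h 0 = 0"
  and ring_hom_1: "ring_hom h \<Longrightarrow> h 1 = 1"
  and ring_hom_add: "ring_hom h \<Longrightarrow> h (a + b) = h a + h b"
  and ring_hom_mult: "ring_hom h \<Longrightarrow> h (a * b) = h a * h b"
  by (auto simp: ring_hom_def)

lemma ring_hom_sum:
  fixes h :: "'a::comm_semiring_1 \<Rightarrow> 'b::comm_semiring_1"
  shows "ring_hom h \<Longrightarrow> h (sum f S) = (\<Sum>x\<in>S. h (f x))"
  by (induction S rule: infinite_finite_induct) (auto simp: ring_hom_0 ring_hom_add)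

lemma ring_hom_prod: "ring_hom h \<Longrightarrow> h (prod f S) = (\<Prod>x\<in>S. h (f x))"
  by (induction S rule: infinite_finite_induct) (auto simp: ring_hom_1 ring_hom_mult)

lemma ring_hom_power: "ring_hom h \<Longrightarrow> h (a ^ n) = h a ^ n"
  by (induction n) (auto simp: ring_hom_1 ring_hom_mult)

lemma ring_hom_diff:
  fixes h :: "'a::comm_ring_1 \<Rightarrow> 'b::comm_ring_1"
  shows "ring_hom h \<Longrightarrow> h (a - b) = h a - h b"
  using ring_hom_add[of h "a - b" b] by (simp add: eq_diff_eq)

lemma ring_hom_comp: "ring_hom g \<Longrightarrow> ring_hom h \<Longrightarrow> ring_hom (\<lambda>x. g (h x))"
  by (auto simp: ring_hom_def)

lemma ring_hom_Const: "ring_hom Const"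
  by (auto simp: ring_hom_def single_add mult_single)

lemma ring_hom_const_poly: "ring_hom (\<lambda>a. [:a:])"
  by (auto simp: ring_hom_def one_pCons mult.commute)

lemma ring_hom_poly: "ring_hom (\<lambda>p. poly p x)"
  by (auto simp: ring_hom_def)

lemma monomial_value_superset:
  assumes "finite S" "Poly_Mapping.keys m \<subseteq> S"
  shows "monomial_value f m = (\<Prod>i\<in>S. f i ^ Poly_Mapping.lookup m i)"
  unfolding monomial_value_def using assms
  by (intro prod.mono_neutral_left) (auto simp: in_keys_iff)

lemma monomial_value_0 [simp]: "monomial_value f 0 = 1"
  by (simp add: monomial_value_def)

lemma monomial_value_single [simp]: "monomial_value f (Poly_Mapping.single i k) = f i ^ k"
  by (simp add: monomial_value_def)

lemma monomial_value_add: "monomial_value f (m + n) = monomial_value f m * monomial_value f n"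
proof -
  let ?S = "Poly_Mapping.keys m \<union> Poly_Mapping.keys n"
  have "monomial_value f (m + n) = (\<Prod>i\<in>?S. f i ^ Poly_Mapping.lookup (m + n) i)"
    by (rule monomial_value_superset) (auto simp: keys_add)
  also have "\<dots> = (\<Prod>i\<in>?S. f i ^ Poly_Mapping.lookup m i) * (\<Prod>i\<in>?S. f i ^ Poly_Mapping.lookup n i)"
    by (simp add: lookup_add power_add prod.distrib)
  also have "\<dots> = monomial_value f m * monomial_value f n"
    by (simp add: monomial_value_superset[of ?S])
  finally show ?thesis .
qed

lemma subst_superset:
  assumes "finite S" "Poly_Mapping.keys p \<subseteq> S" "h 0 = 0"
  shows "subst h f p = (\<Sum>m\<in>S. h (Poly_Mapping.lookup p m) * monomial_value f m)"
  unfolding subst_def using assms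
  by (intro sum.mono_neutral_left) (auto simp: in_keys_iff)

lemma subst_single:
  assumes "h 0 = 0"
  shows "subst h f (Poly_Mapping.single m a) = h a * monomial_value f m"
  using subst_superset[of "{m}" "Poly_Mapping.single m a" h f] assms by simp

lemma mpoly_eq_sum_monomials:
  "p = (\<Sum>m\<in>Poly_Mapping.keys p. Poly_Mapping.single m (Poly_Mapping.lookup p m))"
proof (rule poly_mapping_eqI)
  fix k
  show "Poly_Mapping.lookup p k = Poly_Mapping.lookup (\<Sum>m\<in>Poly_Mapping.keys p. Poly_Mapping.single m (Poly_Mapping.lookup p m)) k"
    by (simp add: lookup_sum lookup_single when_def in_keys_iff)
qed

lemma subst_add:
  assumes "ring_hom h"
  shows "subst h f (p + q) = subst h f p + subst h f q"
proof -
  let ?S = "Poly_Mapping.keys p \<union> Poly_Mapping.keys q"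
  have h0: "h 0 = 0" using assms by (rule ring_hom_0)
  show ?thesis
    by (simp add: subst_superset[of ?S] keys_add h0 lookup_add ring_hom_add[OF assms]
        distrib_right sum.distrib)
qed

lemma subst_sum:
  assumes "ring_hom h"
  shows "subst h f (sum g S) = (\<Sum>x\<in>S. subst h f (g x))"
proof (induction S rule: infinite_finite_induct)
  case (insert x S)
  then show ?case by (simp add: subst_add[OF assms])
qed (simp_all add: subst_def)

lemma ring_hom_subst:
  assumes "ring_hom h"
  shows "ring_hom (subst h f)"
proof -
  have h0: "h 0 = 0" using assms by (rule ring_hom_0)
  have "subst h f (p * q) = subst h f p * subst h f q" for p q
  proof -
    let ?m = "\<lambda>p m. Poly_Mapping.single m (Poly_Mapping.lookup p m)"
    have "p * q = (\<Sum>m\<in>Poly_Mapping.keys p. ?m p m) * (\<Sum>n\<in>Poly_Mapping.keys q. ?m q n)"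
      using mpoly_eq_sum_monomials[of p] mpoly_eq_sum_monomials[of q] by simp
    also have "\<dots> = (\<Sum>m\<in>Poly_Mapping.keys p. \<Sum>n\<in>Poly_Mapping.keys q. ?m p m * ?m q n)"
      by (rule sum_product)
    finally have "subst h f (p * q) =
        (\<Sum>m\<in>Poly_Mapping.keys p. \<Sum>n\<in>Poly_Mapping.keys q. subst h f (?m p m * ?m q n))"
      by (simp add: subst_sum[OF assms])
    also have "\<dots> = (\<Sum>m\<in>Poly_Mapping.keys p. \<Sum>n\<in>Poly_Mapping.keys q.
        (h (Poly_Mapping.lookup p m) * monomial_value f m) * (h (Poly_Mapping.lookup q n) * monomial_value f n))"
      by (intro sum.cong refl) (simp add: mult_single subst_single[of h] h0 monomial_value_add ring_hom_mult[OF assms] mult_ac)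
    also have "\<dots> = subst h f p * subst h f q"
      by (simp add: subst_def sum_product)
    finally show ?thesis .
  qed
  moreover have "subst h f 1 = 1"
    using subst_single[of h f 0 1] h0 ring_hom_1[OF assms] by simp
  ultimately show ?thesis
    by (simp add: ring_hom_def subst_add[OF assms]) (simp add: subst_def)
qed

lemma subst_Const [simp]: "ring_hom h \<Longrightarrow> subst h f (Const a) = h a"
  by (simp add: subst_single ring_hom_0)

lemma subst_Var [simp]: "ring_hom h \<Longrightarrow> subst h f (Var i) = f i"
  by (simp add: Var_def subst_single ring_hom_0 ring_hom_1)

lemma mpoly_eval_eq_subst: "mpoly_eval p n = subst (\<lambda>a. a) n p"
  by (simp add: mpoly_eval_def subst_def monomial_value_def)

lemma ring_hom_mpoly_eval: "ring_hom (\<lambda>p. mpoly_eval p n)"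
  unfolding mpoly_eval_eq_subst by (rule ring_hom_subst) (simp add: ring_hom_def)

lemma mpoly_eval_Const [simp]: "mpoly_eval (Const a) n = a"
  by (simp add: mpoly_eval_eq_subst ring_hom_def)

lemma mpoly_eval_Var [simp]: "mpoly_eval (Var i) n = n i"
  by (simp add: mpoly_eval_eq_subst ring_hom_def)

text \<open>Any set of variables is allowed, not only an initial segment: isolating the variable
  \<open>i\<close> leads from \<open>V\<close> to \<open>V - {i}\<close>, and inductions pass from
  \<open>V\<close> to \<open>insert i V\<close>.\<close>

definition mpolys_in :: "nat set \<Rightarrow> 'a::zero mpoly set" where
  "mpolys_in V = {p. \<forall>m\<in>Poly_Mapping.keys p. Poly_Mapping.keys m \<subseteq> V}"

lemma mpolys_eq: "mpolys r = mpolys_in {..<r}"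
  by (simp add: mpolys_def mpolys_in_def)

lemma mpolys_in_UNIV [simp]: "p \<in> mpolys_in UNIV"
  by (simp add: mpolys_in_def)

lemma mpolys_in_mono: "p \<in> mpolys_in V \<Longrightarrow> V \<subseteq> W \<Longrightarrow> p \<in> mpolys_in W"
  by (auto simp: mpolys_in_def)

lemma mpolys_in_0 [simp]: "0 \<in> mpolys_in V"
  by (simp add: mpolys_in_def)

lemma mpolys_in_Const [simp]: "Const a \<in> mpolys_in V"
  by (auto simp: mpolys_in_def)

lemma mpolys_in_1 [simp]: "1 \<in> mpolys_in V"
  by (auto simp: mpolys_in_def)

lemma mpolys_in_Var: "i \<in> V \<Longrightarrow> Var i \<in> mpolys_in V"
  by (auto simp: Var_def mpolys_in_def)

lemma mpolys_in_add: "p \<in> mpolys_in V \<Longrightarrow> q \<in> mpolys_in V \<Longrightarrow> p + q \<in> mpolys_in V"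
  using keys_add[of p q] by (fastforce simp: mpolys_in_def)

lemma keys_diff_subset:
  fixes p q :: "'a \<Rightarrow>\<^sub>0 'b::ab_group_add"
  shows "Poly_Mapping.keys (p - q) \<subseteq> Poly_Mapping.keys p \<union> Poly_Mapping.keys q"
proof
  fix m assume "m \<in> Poly_Mapping.keys (p - q)"
  then have "Poly_Mapping.lookup p m \<noteq> Poly_Mapping.lookup q m"
    by (simp add: in_keys_iff lookup_minus)
  then show "m \<in> Poly_Mapping.keys p \<union> Poly_Mapping.keys q"
    by (metis UnI1 UnI2 in_keys_iff)
qed

lemma mpolys_in_diff:
  fixes p q :: "'a::ab_group_add mpoly"
  shows "p \<in> mpolys_in V \<Longrightarrow> q \<in> mpolys_in V \<Longrightarrow> p - q \<in> mpolys_in V"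
  using keys_diff_subset[of p q] by (fastforce simp: mpolys_in_def)

lemma mpolys_in_mult:
  assumes "p \<in> mpolys_in V" "q \<in> mpolys_in V"
  shows "p * q \<in> mpolys_in V"
proof -
  have "Poly_Mapping.keys m \<subseteq> V" if m: "m \<in> Poly_Mapping.keys (p * q)" for m
  proof -
    obtain a b where "m = a + b" "a \<in> Poly_Mapping.keys p" "b \<in> Poly_Mapping.keys q"
      using m keys_mult[of p q] by blast
    moreover have "Poly_Mapping.keys a \<subseteq> V" "Poly_Mapping.keys b \<subseteq> V"
      using assms calculation by (simp_all add: mpolys_in_def)
    ultimately show ?thesis using keys_add[of a b] by blast
  qed
  then show ?thesis by (auto simp: mpolys_in_def)
qed

lemma mpolys_in_power: "p \<in> mpolys_in V \<Longrightarrow> p ^ n \<in> mpolys_in V"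
  by (induction n) (auto intro: mpolys_in_mult)

lemma mpolys_in_sum: "(\<And>x. x \<in> S \<Longrightarrow> f x \<in> mpolys_in V) \<Longrightarrow> sum f S \<in> mpolys_in V"
  by (induction S rule: infinite_finite_induct) (auto intro: mpolys_in_add)

lemma mpolys_in_prod: "(\<And>x. x \<in> S \<Longrightarrow> f x \<in> mpolys_in V) \<Longrightarrow> prod f S \<in> mpolys_in V"
  by (induction S rule: infinite_finite_induct) (auto intro: mpolys_in_mult)

lemma mpolys_in_finite_vars:
  obtains r where "p \<in> mpolys_in {..<r}"
proof -
  let ?S = "\<Union>m\<in>Poly_Mapping.keys p. Poly_Mapping.keys m"
  have "finite ?S" by simp
  then obtain r where "?S \<subseteq> {..<r}" using finite_nat_iff_bounded by blast
  then show ?thesis by (intro that[of r]) (auto simp: mpolys_in_def)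
qed

lemma single_eq_Const_mult:
  fixes a :: "'a::comm_semiring_1"
  shows "Poly_Mapping.single m a = Const a * monomial_value Var m"
proof -
  have *: "monomial_value (Var :: nat \<Rightarrow> 'a mpoly) m = Poly_Mapping.single m 1"
  proof -
    have pow: "(Var i :: 'a mpoly) ^ k = Poly_Mapping.single (Poly_Mapping.single i k) 1" for i k
      by (induction k) (auto simp: Var_def mult_single single_add[symmetric])
    have pr: "(\<Prod>i\<in>S. Poly_Mapping.single (g i) (1::'a)) = Poly_Mapping.single (\<Sum>i\<in>S. g i) 1"
      for S and g :: "nat \<Rightarrow> (nat \<Rightarrow>\<^sub>0 nat)"
      by (induction S rule: infinite_finite_induct) (auto simp: mult_single)
    have "m = (\<Sum>i\<in>Poly_Mapping.keys m. Poly_Mapping.single i (Poly_Mapping.lookup m i))"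
      by (rule poly_mapping_eqI) (simp add: lookup_sum lookup_single when_def in_keys_iff)
    then show ?thesis by (simp add: monomial_value_def pow pr)
  qed
  show ?thesis unfolding * by (simp add: mult_single)
qed

text \<open>A monomial is a constant times a product of variables, so a ring homomorphism is
  determined by the images of \<open>Const a\<close> and \<open>Var i\<close>. Identities such as
  \<open>poly_to_poly_Var\<close> and \<open>mpoly_eval_to_poly\<close> are then checked on these
  generators.\<close>

lemma ring_hom_eq_subst:
  assumes "ring_hom g"
  shows "g p = subst (\<lambda>a. g (Const a)) (\<lambda>i. g (Var i)) p"
proof -
  have "g (monomial_value Var m) = monomial_value (\<lambda>i. g (Var i)) m" for m
    by (simp add: monomial_value_def ring_hom_prod[OF assms] ring_hom_power[OF assms])
  then have *: "g (Poly_Mapping.single m a) = g (Const a) * monomial_value (\<lambda>i. g (Var i)) m" for m a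
    by (metis ring_hom_mult[OF assms] single_eq_Const_mult)
  show ?thesis
    unfolding subst_def *[symmetric] ring_hom_sum[OF assms, symmetric]
    by (simp add: mpoly_eq_sum_monomials[symmetric])
qed

lemma ring_hom_eqI:
  assumes "ring_hom g" "ring_hom h" "p \<in> mpolys_in V"
    and "\<And>a. g (Const a) = h (Const a)" "\<And>i. i \<in> V \<Longrightarrow> g (Var i) = h (Var i)"
  shows "g p = h p"
proof -
  have "g p = subst (\<lambda>a. g (Const a)) (\<lambda>i. g (Var i)) p"
    by (rule ring_hom_eq_subst[OF assms(1)])
  also have "\<dots> = subst (\<lambda>a. h (Const a)) (\<lambda>i. h (Var i)) p"
    using assms(3-5) unfolding subst_def monomial_value_def mpolys_in_def
    by (intro sum.cong prod.cong arg_cong2[where f = "(*)"] arg_cong2[where f = "(^)"] refl) auto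
  also have "\<dots> = h p"
    by (rule ring_hom_eq_subst[OF assms(2), symmetric])
  finally show ?thesis .
qed

lemma mpoly_eval_cong:
  assumes "p \<in> mpolys_in V" "\<And>i. i \<in> V \<Longrightarrow> n i = n' i"
  shows "mpoly_eval p n = mpoly_eval p n'"
  by (rule ring_hom_eqI[OF ring_hom_mpoly_eval ring_hom_mpoly_eval assms(1)]) (use assms(2) in auto)

text \<open>\<open>subst\<close> forms only sums and products of values of \<open>h\<close> and
  \<open>f\<close>. This serves to confine the coefficients of \<open>to_poly i p\<close> to the
  variables other than \<open>i\<close>.\<close>

lemma subst_closed:
  assumes "p \<in> mpolys_in V" "\<And>a. h a \<in> S" "\<And>i. i \<in> V \<Longrightarrow> f i \<in> S" "0 \<in> S" "1 \<in> S"
    and add: "\<And>a b. a \<in> S \<Longrightarrow> b \<in> S \<Longrightarrow> a + b \<in> S"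
    and mult: "\<And>a b. a \<in> S \<Longrightarrow> b \<in> S \<Longrightarrow> a * b \<in> S"
  shows "subst h f p \<in> S"
proof -
  have sumS: "sum g T \<in> S" if "\<And>x. x \<in> T \<Longrightarrow> g x \<in> S" for g :: "(nat \<Rightarrow>\<^sub>0 nat) \<Rightarrow> 'b" and T
    using that by (induction T rule: infinite_finite_induct) (auto intro: assms add)
  have prodS: "prod g T \<in> S" if "\<And>x. x \<in> T \<Longrightarrow> g x \<in> S" for g :: "nat \<Rightarrow> 'b" and T
    using that by (induction T rule: infinite_finite_induct) (auto intro: assms mult)
  have powS: "a ^ n \<in> S" if "a \<in> S" for a n
    using that by (induction n) (auto intro: assms mult)
  show ?thesis
    unfolding subst_def monomial_value_def
    using assms(1) by (intro sumS mult prodS powS assms) (auto simp: mpolys_in_def)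
qed

text \<open>\<open>to_poly i\<close> reads a multivariate polynomial as a univariate one in the variable \<open>i\<close>.\<close>

definition to_poly :: "nat \<Rightarrow> 'a::comm_ring_1 mpoly \<Rightarrow> 'a mpoly poly" where
  "to_poly i = subst (\<lambda>a. [:Const a:]) (\<lambda>j. if j = i then [:0, 1:] else [:Var j:])"

lemma ring_hom_to_poly: "ring_hom (to_poly i)"
  unfolding to_poly_def
  by (intro ring_hom_subst ring_hom_comp[OF ring_hom_const_poly ring_hom_Const])

lemmas to_poly_mult = ring_hom_mult[OF ring_hom_to_poly]
  and to_poly_0 [simp] = ring_hom_0[OF ring_hom_to_poly]
  and to_poly_diff = ring_hom_diff[OF ring_hom_to_poly]
  and to_poly_power = ring_hom_power[OF ring_hom_to_poly]

lemma to_poly_Const [simp]: "to_poly i (Const a) = [:Const a:]"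
  and to_poly_Var [simp]: "to_poly i (Var j) = (if j = i then [:0, 1:] else [:Var j:])"
  unfolding to_poly_def
  by (simp_all add: ring_hom_comp[OF ring_hom_const_poly ring_hom_Const])

lemma coeff_to_poly_in:
  assumes "p \<in> mpolys_in V"
  shows "coeff (to_poly i p) k \<in> mpolys_in (V - {i})"
proof -
  let ?S = "{q. \<forall>k. coeff q k \<in> mpolys_in (V - {i})}"
  have "to_poly i p \<in> ?S"
    unfolding to_poly_def
    by (rule subst_closed[OF assms])
      (auto simp: coeff_pCons coeff_mult mpolys_in_Var split: nat.splits
        intro!: mpolys_in_add mpolys_in_sum mpolys_in_mult)
  then show ?thesis by simp
qed

lemma poly_to_poly_Var: "poly (to_poly i p) (Var i) = p"
  using ring_hom_eqI[OF ring_hom_comp[OF ring_hom_poly ring_hom_to_poly[of i]], of "\<lambda>p. p" p UNIV]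
  by (auto simp: ring_hom_def)

lemma to_poly_free:
  assumes "p \<in> mpolys_in V" "i \<notin> V"
  shows "to_poly i p = [:p:]"
  by (rule ring_hom_eqI[OF ring_hom_to_poly ring_hom_const_poly assms(1)]) (use assms(2) in auto)

lemma to_poly_eq_0_iff [simp]: "to_poly i p = 0 \<longleftrightarrow> p = 0"
  by (metis poly_to_poly_Var poly_0 to_poly_0)

lemma mpoly_eq_sum_coeff:
  "p = (\<Sum>k\<le>degree (to_poly i p). coeff (to_poly i p) k * Var i ^ k)"
  using poly_to_poly_Var[of i p] by (simp add: poly_altdef)

text \<open>Lets the values along a line in direction \<open>i\<close> be treated as the values of
  one univariate polynomial over the base ring.\<close>

lemma mpoly_eval_to_poly:
  "mpoly_eval p (n(i := y)) = poly (map_poly (\<lambda>c. mpoly_eval c n) (to_poly i p)) y"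
proof -
  have hom: "ring_hom (map_poly (\<lambda>c. mpoly_eval c n))"
    using ring_hom_mpoly_eval[of n] unfolding ring_hom_def
    by (auto intro!: poly_eqI simp: coeff_map_poly coeff_mult one_pCons map_poly_pCons
        ring_hom_sum[OF ring_hom_mpoly_eval])
  show ?thesis
    by (rule ring_hom_eqI[OF ring_hom_mpoly_eval
          ring_hom_comp[OF ring_hom_poly ring_hom_comp[OF hom ring_hom_to_poly]], of _ UNIV])
      (auto simp: map_poly_pCons ring_hom_0[OF ring_hom_mpoly_eval] ring_hom_1[OF ring_hom_mpoly_eval])
qed

section \<open>Passage between integer and rational coefficients\<close>

lemma lookup_rat_mpoly: "Poly_Mapping.lookup (rat_mpoly p) m = of_int (Poly_Mapping.lookup p m)"
  unfolding rat_mpoly_def by (simp add: Poly_Mapping.map.rep_eq when_def)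

lemma ring_hom_rat_mpoly: "ring_hom rat_mpoly"
proof -
  let ?h = "\<lambda>a. Const (rat_of_int a)"
  have h: "ring_hom ?h"
    by (rule ring_hom_comp[OF ring_hom_Const]) (simp add: ring_hom_def)
  have "rat_mpoly p = subst ?h Var p" for p
  proof (rule poly_mapping_eqI)
    fix k
    have "subst ?h Var p = (\<Sum>m\<in>Poly_Mapping.keys p. Poly_Mapping.single m (rat_of_int (Poly_Mapping.lookup p m)))"
      by (simp add: subst_def single_eq_Const_mult[symmetric] del: single_of_int)
    then show "Poly_Mapping.lookup (rat_mpoly p) k = Poly_Mapping.lookup (subst ?h Var p) k"
      by (simp add: lookup_rat_mpoly lookup_sum lookup_single when_def in_keys_iff)
  qed
  then show ?thesis using ring_hom_subst[OF h, of Var] by presburger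
qed

lemma keys_rat_mpoly [simp]: "Poly_Mapping.keys (rat_mpoly p) = Poly_Mapping.keys p"
  by (auto simp: in_keys_iff lookup_rat_mpoly)

lemma rat_mpoly_in [simp]: "rat_mpoly p \<in> mpolys_in V \<longleftrightarrow> p \<in> mpolys_in V"
  by (simp add: mpolys_in_def)

lemma inj_rat_mpoly: "inj rat_mpoly"
  by (rule injI, rule poly_mapping_eqI) (metis lookup_rat_mpoly of_int_eq_iff)

lemma rat_mpoly_eq_0_iff [simp]: "rat_mpoly p = 0 \<longleftrightarrow> p = 0"
  by (metis inj_rat_mpoly injD ring_hom_0 ring_hom_rat_mpoly)

lemma clear_denominators:
  obtains N :: int and q where "N > 0" "Const (of_int N) * p = rat_mpoly q"
    "\<And>V. p \<in> mpolys_in V \<Longrightarrow> q \<in> mpolys_in V"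
proof -
  define N where "N = (\<Prod>m\<in>Poly_Mapping.keys p. snd (quotient_of (Poly_Mapping.lookup p m)))"
  have N: "N > 0" unfolding N_def by (intro prod_pos) (auto simp: quotient_of_denom_pos')
  have int: "rat_of_int N * Poly_Mapping.lookup p m \<in> \<int>" for m
  proof (cases "m \<in> Poly_Mapping.keys p")
    case True
    define a b where "a = fst (quotient_of (Poly_Mapping.lookup p m))" "b = snd (quotient_of (Poly_Mapping.lookup p m))"
    have ab: "Poly_Mapping.lookup p m = of_int a / of_int b" "b > 0"
      unfolding a_b_def by (simp_all add: quotient_of_div quotient_of_denom_pos')
    have "b dvd N" unfolding N_def a_b_def using True by (intro dvd_prodI) auto
    then obtain k where "N = b * k" by auto
    then have "rat_of_int N * Poly_Mapping.lookup p m = of_int (a * k)" using ab by simp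
    then show ?thesis by (metis Ints_of_int)
  qed (simp add: in_keys_iff)
  define q where "q = (\<Sum>m\<in>Poly_Mapping.keys p. Poly_Mapping.single m \<lfloor>rat_of_int N * Poly_Mapping.lookup p m\<rfloor>)"
  have lq: "Poly_Mapping.lookup q m = \<lfloor>rat_of_int N * Poly_Mapping.lookup p m\<rfloor>" for m
    by (simp add: q_def lookup_sum lookup_single when_def in_keys_iff)
  have "rat_mpoly q = (\<Sum>m\<in>Poly_Mapping.keys p. Poly_Mapping.single m (rat_of_int N * Poly_Mapping.lookup p m))"
    by (rule poly_mapping_eqI)
      (use int in \<open>auto simp: lookup_rat_mpoly lq lookup_sum lookup_single when_def in_keys_iff of_int_floor_cancel\<close>)
  also have "\<dots> = Const (of_int N) * (\<Sum>m\<in>Poly_Mapping.keys p. Poly_Mapping.single m (Poly_Mapping.lookup p m))"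
    by (simp add: sum_distrib_left mult_single del: single_of_int)
  finally have "Const (of_int N) * p = rat_mpoly q"
    using mpoly_eq_sum_monomials[of p] by simp
  moreover have "Poly_Mapping.keys q \<subseteq> Poly_Mapping.keys p"
    by (auto simp: lq in_keys_iff)
  then have "q \<in> mpolys_in V" if "p \<in> mpolys_in V" for V
    using that by (auto simp: mpolys_in_def)
  ultimately show ?thesis
    using N that by blast
qed

section \<open>Unique factorisation over a field\<close>

lemma degree_to_poly_mult:
  fixes p q :: "'a::idom mpoly"
  shows "p \<noteq> 0 \<Longrightarrow> q \<noteq> 0 \<Longrightarrow> degree (to_poly i (p * q)) = degree (to_poly i p) + degree (to_poly i q)"
  by (simp add: to_poly_mult degree_mult_eq)

lemma degree_to_poly_0_imp_in:
  assumes "degree (to_poly i p) = 0" "p \<in> mpolys_in V"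
  shows "p \<in> mpolys_in (V - {i})"
proof -
  have "p = coeff (to_poly i p) 0"
    using mpoly_eq_sum_coeff[of p i] assms(1) by simp
  then show ?thesis using coeff_to_poly_in[OF assms(2)] by metis
qed

lemma degree_to_poly_free:
  "p \<in> mpolys_in V \<Longrightarrow> i \<notin> V \<Longrightarrow> degree (to_poly i p) = 0"
  by (simp add: to_poly_free)

text \<open>In a domain the degree in a variable outside \<open>V\<close> is additive, hence
  \<open>0\<close> for every divisor of a nonzero \<open>p\<close>. This keeps divisors and
  cofactors inside the polynomial ring, although \<open>dvd\<close> refers to the whole
  type.\<close>

lemma mpolys_in_dvd:
  fixes p q :: "'a::idom mpoly"
  assumes "q dvd p" "p \<noteq> 0" "p \<in> mpolys_in V"
  shows "q \<in> mpolys_in V"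
proof -
  obtain e where e: "p = q * e" using assms(1) by auto
  have "q \<in> mpolys_in (UNIV - {i})" if "i \<notin> V" for i
  proof (rule degree_to_poly_0_imp_in)
    have "degree (to_poly i p) = 0" by (rule degree_to_poly_free[OF assms(3) that])
    then show "degree (to_poly i q) = 0"
      using degree_to_poly_mult[of q e i] e assms(2) by simp
  qed simp
  then show ?thesis by (fastforce simp: mpolys_in_def)
qed

lemma mpolys_in_empty:
  assumes "p \<in> mpolys_in {}"
  shows "p = Const (Poly_Mapping.lookup p 0)"
proof -
  have "Poly_Mapping.keys p \<subseteq> {0}"
    using assms by (auto simp: mpolys_in_def)
  then show ?thesis
    by (intro poly_mapping_eqI) (auto simp: lookup_single when_def in_keys_iff)
qed

lemma is_unit_mpoly_iff:
  fixes p :: "'a::field mpoly"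
  shows "p dvd 1 \<longleftrightarrow> p \<noteq> 0 \<and> p \<in> mpolys_in {}"
proof
  assume "p dvd 1"
  then show "p \<noteq> 0 \<and> p \<in> mpolys_in {}"
    using mpolys_in_dvd[of p 1 "{}"] by auto
next
  assume p: "p \<noteq> 0 \<and> p \<in> mpolys_in {}"
  define a where "a = Poly_Mapping.lookup p 0"
  have pa: "p = Const a" using mpolys_in_empty p unfolding a_def by blast
  with p have "a \<noteq> 0" by auto
  then have "1 = p * Const (1 / a)" by (simp add: pa mult_single)
  then show "p dvd 1" by (rule dvdI)
qed

text \<open>Translates the degree condition of \<open>coprime_family\<close> into membership in
  \<open>mpolys_in {}\<close>, the form used from here on. By the convention for the zero polynomial
  both sides hold for \<open>0\<close>.\<close>

lemma mpoly_degree_eq_0_iff: "mpoly_degree p = 0 \<longleftrightarrow> p \<in> mpolys_in {}"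
proof
  assume 0: "mpoly_degree p = 0"
  have "(\<Sum>i\<in>Poly_Mapping.keys m. Poly_Mapping.lookup m i) \<le> mpoly_degree p"
    if "m \<in> Poly_Mapping.keys p" for m
    unfolding mpoly_degree_def using that by (intro Max_ge) auto
  then have "Poly_Mapping.lookup m i = 0" if "m \<in> Poly_Mapping.keys p" "i \<in> Poly_Mapping.keys m" for m i
    using that 0 by simp
  then have "Poly_Mapping.keys m = {}" if "m \<in> Poly_Mapping.keys p" for m
    using that by (fastforce simp: in_keys_iff)
  then show "p \<in> mpolys_in {}" by (simp add: mpolys_in_def)
next
  assume "p \<in> mpolys_in {}"
  then have "insert 0 ((\<lambda>m. \<Sum>i\<in>Poly_Mapping.keys m. Poly_Mapping.lookup m i) ` Poly_Mapping.keys p) = {0}"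
    by (auto simp: mpolys_in_def)
  then show "mpoly_degree p = 0"
    unfolding mpoly_degree_def by (simp only: Max_singleton)
qed

text \<open>Measure for well-founded induction on proper divisors. Additivity of the partial degrees
  comes directly from the univariate case.\<close>

definition degree_sum :: "nat \<Rightarrow> 'a::comm_ring_1 mpoly \<Rightarrow> nat" where
  "degree_sum r p = (\<Sum>i<r. degree (to_poly i p))"

lemma degree_sum_less:
  fixes a b :: "'a::field mpoly"
  assumes "a * b \<in> mpolys_in {..<r}" "a * b \<noteq> 0" "\<not> b dvd 1"
  shows "degree_sum r a < degree_sum r (a * b)"
proof -
  have b: "b \<in> mpolys_in {..<r}"
    using mpolys_in_dvd[of b "a * b"] assms by auto
  have "degree_sum r b > 0"
  proof (rule ccontr)
    assume "\<not> ?thesis"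
    then have "degree (to_poly i b) = 0" if "i < r" for i
      using that by (simp add: degree_sum_def)
    then have "b \<in> mpolys_in ({..<r} - {i})" if "i < r" for i
      using that b by (intro degree_to_poly_0_imp_in) auto
    then have "b \<in> mpolys_in {}"
      using b unfolding mpolys_in_def by blast
    then show False using assms(2,3) by (auto simp: is_unit_mpoly_iff)
  qed
  moreover have "degree_sum r (a * b) = degree_sum r a + degree_sum r b"
    using assms(2) by (simp add: degree_sum_def degree_to_poly_mult sum.distrib)
  ultimately show ?thesis by simp
qed

lemma irreducible_divisor_exists:
  fixes p :: "'a::field mpoly"
  assumes "p \<noteq> 0" "\<not> p dvd 1"
  obtains q where "irreducible q" "q dvd p"
proof -
  obtain r where "p \<in> mpolys_in {..<r}" by (rule mpolys_in_finite_vars)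
  then have "\<exists>q. irreducible q \<and> q dvd p"
    using assms
  proof (induction "degree_sum r p" arbitrary: p rule: less_induct)
    case less
    show ?case
    proof (cases "irreducible p")
      case False
      then obtain a b where ab: "p = a * b" "\<not> a dvd 1" "\<not> b dvd 1"
        using less.prems by (auto simp: irreducible_def)
      have "degree_sum r a < degree_sum r p"
        using degree_sum_less[of a b r] ab less.prems by simp
      moreover have "a \<in> mpolys_in {..<r}"
        using mpolys_in_dvd[of a p] ab less.prems by simp
      ultimately obtain q where "irreducible q" "q dvd a"
        using less.hyps[of a] ab less.prems by auto
      then show ?thesis using ab by auto
    qed auto
  qed
  then show ?thesis using that by blast
qed

text \<open>Primality tested only against factors from \<open>S\<close>, so that the induction on
  the number of variables can speak of primality in a subring without changing the type.\<close>

definition prime_in :: "'a::comm_semiring_1 set \<Rightarrow> 'a \<Rightarrow> bool" where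
  "prime_in S p \<longleftrightarrow> (\<forall>a\<in>S. \<forall>b\<in>S. p dvd a * b \<longrightarrow> p dvd a \<or> p dvd b)"

text \<open>As \<open>p\<close> is free of the variable \<open>i\<close>, multiplication by
  \<open>p\<close> acts coefficientwise on \<open>to_poly i\<close>.\<close>

lemma dvd_iff_dvd_coeffs:
  fixes p q :: "'a::comm_ring_1 mpoly"
  assumes "p \<in> mpolys_in V" "i \<notin> V"
  shows "p dvd q \<longleftrightarrow> (\<forall>k. p dvd coeff (to_poly i q) k)"
proof
  assume "p dvd q"
  then obtain e where "q = p * e" by auto
  then have "to_poly i q = smult p (to_poly i e)"
    by (simp add: to_poly_mult to_poly_free[OF assms])
  then show "\<forall>k. p dvd coeff (to_poly i q) k" by simp
next
  assume "\<forall>k. p dvd coeff (to_poly i q) k"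
  then have "p dvd (\<Sum>k\<le>degree (to_poly i q). coeff (to_poly i q) k * Var i ^ k)"
    by (intro dvd_sum dvd_mult2) auto
  then show "p dvd q" using mpoly_eq_sum_coeff[of q i] by simp
qed

text \<open>Gauss's lemma. If \<open>p\<close> divided neither factor, take in each the first
  coefficient not divisible by \<open>p\<close>, with indices \<open>k\<close> and \<open>l\<close>;
  in the coefficient of index \<open>k + l\<close> of the product every other term is divisible by
  \<open>p\<close>.\<close>

lemma prime_in_insert:
  fixes p :: "'a::comm_ring_1 mpoly"
  assumes p: "p \<in> mpolys_in V" and i: "i \<notin> V" and prime: "prime_in (mpolys_in V) p"
  shows "prime_in (mpolys_in (insert i V)) p"
  unfolding prime_in_def
proof (intro ballI impI, rule ccontr)
  fix a b assume ab: "a \<in> mpolys_in (insert i V)" "b \<in> mpolys_in (insert i V)"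
    and dvd: "p dvd a * b" and "\<not> (p dvd a \<or> p dvd b)"
  then have na: "\<exists>k. \<not> p dvd coeff (to_poly i a) k" and nb: "\<exists>k. \<not> p dvd coeff (to_poly i b) k"
    using dvd_iff_dvd_coeffs[OF p i] by blast+
  define k where "k = (LEAST k. \<not> p dvd coeff (to_poly i a) k)"
  define l where "l = (LEAST l. \<not> p dvd coeff (to_poly i b) l)"
  have k: "\<not> p dvd coeff (to_poly i a) k" "\<And>j. j < k \<Longrightarrow> p dvd coeff (to_poly i a) j"
    unfolding k_def using LeastI_ex[OF na] not_less_Least by blast+
  have l: "\<not> p dvd coeff (to_poly i b) l" "\<And>j. j < l \<Longrightarrow> p dvd coeff (to_poly i b) j"
    unfolding l_def using LeastI_ex[OF nb] not_less_Least by blast+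
  let ?t = "\<lambda>j. coeff (to_poly i a) j * coeff (to_poly i b) (k + l - j)"
  have "coeff (to_poly i (a * b)) (k + l) = (\<Sum>j\<le>k+l. ?t j)"
    by (simp add: to_poly_mult coeff_mult)
  also have "\<dots> = ?t k + (\<Sum>j\<in>{..k+l}-{k}. ?t j)"
    by (rule sum.remove) auto
  finally have sum: "coeff (to_poly i (a * b)) (k + l) = ?t k + (\<Sum>j\<in>{..k+l}-{k}. ?t j)" .
  have "p dvd ?t j" if j: "j \<in> {..k+l}-{k}" for j
  proof (cases "j < k")
    case False
    then have "k + l - j < l" using j by auto
    then have "p dvd coeff (to_poly i b) (k + l - j)" by (rule l(2))
    then show ?thesis by (rule dvd_mult)
  qed (use k(2) in \<open>auto intro: dvd_mult2\<close>)
  then have "p dvd (\<Sum>j\<in>{..k+l}-{k}. ?t j)" by (rule dvd_sum)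
  moreover have "p dvd coeff (to_poly i (a * b)) (k + l)"
    using dvd dvd_iff_dvd_coeffs[OF p i] by blast
  ultimately have "p dvd ?t k"
    unfolding sum by (simp add: dvd_add_left_iff)
  moreover have "coeff (to_poly i a) k \<in> mpolys_in V" "coeff (to_poly i b) l \<in> mpolys_in V"
    using coeff_to_poly_in[OF ab(1), of i k] coeff_to_poly_in[OF ab(2), of i l]
      mpolys_in_mono[of _ "insert i V - {i}" V] by auto
  ultimately show False using prime k(1) l(1) by (auto simp: prime_in_def)
qed

text \<open>Division in the variable \<open>i\<close> without inverting coefficients: each step
  multiplies by the leading coefficient \<open>L\<close> of \<open>m\<close>, so \<open>c\<close> is
  a power of \<open>L\<close>. The remainder is described by vanishing coefficients and not by its
  degree, so that \<open>rem = 0\<close> is forced when \<open>m\<close> has degree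
  \<open>0\<close>.\<close>

lemma pseudo_division:
  fixes m a :: "'a::idom mpoly"
  assumes i: "i \<notin> V" and m: "m \<in> mpolys_in (insert i V)" "m \<noteq> 0"
    and a: "a \<in> mpolys_in (insert i V)"
  obtains c q rem where "c \<in> mpolys_in V" "c \<noteq> 0" "q \<in> mpolys_in (insert i V)"
    "c * a = q * m + rem" "\<And>k. k \<ge> degree (to_poly i m) \<Longrightarrow> coeff (to_poly i rem) k = 0"
proof -
  let ?d = "degree (to_poly i m)"
  define L where "L = lead_coeff (to_poly i m)"
  have coeff_in: "coeff (to_poly i p) k \<in> mpolys_in V" if "p \<in> mpolys_in (insert i V)" for p :: "'a mpoly" and k
    using coeff_to_poly_in[OF that, of i k] mpolys_in_mono[of _ "insert i V - {i}" V] by auto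
  have L: "L \<in> mpolys_in V" "L \<noteq> 0"
    using coeff_in[OF m(1)] m(2) by (auto simp: L_def)
  have up: "p \<in> mpolys_in (insert i V)" if "p \<in> mpolys_in V" for p :: "'a mpoly"
    using that by (rule mpolys_in_mono) auto
  \<comment> \<open>Induction on a bound \<open>n\<close> beyond which the coefficients vanish, not
    on the degree; the zero polynomial is then the ordinary case \<open>n = 0\<close>.\<close>
  have "\<exists>c q rem. c \<in> mpolys_in V \<and> c \<noteq> 0 \<and> q \<in> mpolys_in (insert i V) \<and>
    c * a = q * m + rem \<and> (\<forall>k\<ge>?d. coeff (to_poly i rem) k = 0)"
    if "\<forall>k\<ge>n. coeff (to_poly i a) k = 0" for n
    using that a
  proof (induction n arbitrary: a)
    case 0
    show ?case
      by (rule exI[of _ 1], rule exI[of _ 0], rule exI[of _ a]) (use 0 in auto)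
  next
    case (Suc n)
    show ?case
    proof (cases "n < ?d")
      case True
      then show ?thesis
        by (intro exI[of _ 1] exI[of _ 0] exI[of _ a]) (use Suc.prems in auto)
    next
      case False
      define b where "b = coeff (to_poly i a) n"
      define e where "e = n - ?d"
      \<comment> \<open>Cross-multiplying with \<open>L\<close> and \<open>b\<close> cancels the
        coefficient of index \<open>n\<close>, which lowers the bound by one.\<close>
      define a' where "a' = L * a - b * Var i ^ e * m"
      have b: "b \<in> mpolys_in V" unfolding b_def using Suc.prems by (intro coeff_in)
      have poly_a': "to_poly i a' = smult L (to_poly i a) - smult b (monom 1 e * to_poly i m)"
        by (simp add: a'_def to_poly_diff to_poly_mult to_poly_power to_poly_free[OF L(1) i]
            to_poly_free[OF b i] monom_altdef)
      have "coeff (to_poly i a') k = 0" if "k \<ge> n" for k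
      proof (cases "k = n")
        case True
        then show ?thesis using False
          by (simp add: poly_a' coeff_monom_mult e_def b_def L_def)
      next
        case False
        then have "k \<ge> Suc n" "k - e > ?d" using that \<open>\<not> n < ?d\<close> by (auto simp: e_def)
        then show ?thesis using Suc.prems(1)
          by (simp add: poly_a' coeff_monom_mult coeff_eq_0)
      qed
      moreover have "a' \<in> mpolys_in (insert i V)"
        unfolding a'_def using up[OF L(1)] up[OF b] m Suc.prems
        by (intro mpolys_in_diff mpolys_in_mult mpolys_in_power mpolys_in_Var) auto
      ultimately obtain c q rem where c: "c \<in> mpolys_in V" "c \<noteq> 0" "q \<in> mpolys_in (insert i V)"
        "c * a' = q * m + rem" "\<forall>k\<ge>?d. coeff (to_poly i rem) k = 0"
        using Suc.IH[of a'] by blast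
      have "(c * L) * a = (q + c * (b * Var i ^ e)) * m + rem"
        using c(4) by (simp add: a'_def algebra_simps)
      moreover have "q + c * (b * Var i ^ e) \<in> mpolys_in (insert i V)"
        using c(3) up[OF c(1)] up[OF b]
        by (intro mpolys_in_add mpolys_in_mult mpolys_in_power mpolys_in_Var) auto
      moreover have "c * L \<in> mpolys_in V" "c * L \<noteq> 0"
        using c L by (auto intro: mpolys_in_mult)
      ultimately show ?thesis using c(5) by blast
    qed
  qed
  moreover have "\<forall>k\<ge>Suc (degree (to_poly i a)). coeff (to_poly i a) k = 0"
    by (simp add: coeff_eq_0)
  ultimately show ?thesis using that by blast
qed

text \<open>For nonzero \<open>p\<close> this is trivial content over the coefficient ring in the
  variables \<open>V\<close>, phrased without gcds of coefficients.\<close>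

definition primitive_over :: "nat set \<Rightarrow> 'a::comm_ring_1 mpoly \<Rightarrow> bool" where
  "primitive_over V p \<longleftrightarrow> (\<forall>q\<in>mpolys_in V. irreducible q \<longrightarrow> \<not> q dvd p)"

lemma primitive_over_exists:
  fixes m :: "'a::field mpoly"
  assumes "m \<noteq> 0"
  obtains c p where "c \<in> mpolys_in V" "c \<noteq> 0" "m = c * p" "primitive_over V p"
proof -
  obtain r where "m \<in> mpolys_in {..<r}" by (rule mpolys_in_finite_vars)
  then have "\<exists>c p. c \<in> mpolys_in V \<and> c \<noteq> 0 \<and> m = c * p \<and> primitive_over V p"
    using assms
  proof (induction "degree_sum r m" arbitrary: m rule: less_induct)
    case less
    show ?case
    proof (cases "primitive_over V m")
      case True
      then show ?thesis by (intro exI[of _ 1] exI[of _ m]) auto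
    next
      case False
      then obtain q a where q: "q \<in> mpolys_in V" "irreducible q" "m = a * q"
        by (auto simp: primitive_over_def dvd_def mult.commute)
      have "degree_sum r a < degree_sum r m"
        unfolding q(3) using q less.prems by (intro degree_sum_less) (auto simp: irreducible_def)
      moreover have "a \<in> mpolys_in {..<r}" using mpolys_in_dvd[of a m] q(3) less.prems by simp
      moreover have "a \<noteq> 0" using q(3) less.prems by auto
      ultimately obtain c p where "c \<in> mpolys_in V" "c \<noteq> 0" "a = c * p" "primitive_over V p"
        using less.hyps by blast
      moreover have "c * q \<in> mpolys_in V" "c * q \<noteq> 0" "m = (c * q) * p"
        using q calculation by (auto intro: mpolys_in_mult simp: irreducible_def mult_ac)
      ultimately show ?thesis by blast
    qed
  qed
  then show ?thesis using that by blast
qed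

text \<open>Write \<open>c * a = p * e\<close>. An irreducible factor \<open>q\<close> of
  \<open>c\<close> is prime by assumption and does not divide the primitive \<open>p\<close>, so it
  divides \<open>e\<close> and can be cancelled on both sides; this is repeated until
  \<open>c\<close> is a unit.\<close>

lemma primitive_over_dvd_cancel:
  fixes p :: "'a::field mpoly"
  assumes prime: "\<And>q :: 'a mpoly. q \<in> mpolys_in V \<Longrightarrow> irreducible q \<Longrightarrow> prime_in (mpolys_in W) q"
    and "V \<subseteq> W" and p: "primitive_over V p" "p \<in> mpolys_in W"
    and c: "c \<in> mpolys_in V" "c \<noteq> 0" and a: "a \<in> mpolys_in W" and "p dvd c * a"
  shows "p dvd a"
proof (cases "a = 0")
  case False
  obtain r where "c \<in> mpolys_in {..<r}" by (rule mpolys_in_finite_vars)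
  then show ?thesis using c \<open>p dvd c * a\<close>
  proof (induction "degree_sum r c" arbitrary: c rule: less_induct)
    case less
    obtain e where e: "c * a = p * e" using less.prems by auto
    show ?case
    proof (cases "c dvd 1")
      case True
      then obtain d where "1 = c * d" by auto
      then have "a = (c * a) * d" by (metis mult.assoc mult.commute mult_1)
      then show ?thesis using less.prems by (metis dvd_mult2)
    next
      case False
      then obtain q where q: "irreducible q" "q dvd c"
        using less.prems irreducible_divisor_exists by blast
      then obtain c' where c': "c = c' * q" by (auto simp: dvd_def mult.commute)
      have c'0: "c' \<noteq> 0" using c' less.prems by auto
      have "q \<in> mpolys_in V" using mpolys_in_dvd[OF q(2)] less.prems by auto
      moreover have "e \<in> mpolys_in W"
      proof (rule mpolys_in_dvd[of e "c * a"])
        show "e dvd c * a" by (simp add: e)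
        show "c * a \<noteq> 0" using less.prems \<open>a \<noteq> 0\<close> by simp
        show "c * a \<in> mpolys_in W" using less.prems a mpolys_in_mono[OF _ \<open>V \<subseteq> W\<close>] by (intro mpolys_in_mult) auto
      qed
      moreover have "q dvd p * e" using c' by (simp flip: e)
      ultimately have "q dvd e"
        using prime q(1) p by (auto simp: prime_in_def primitive_over_def)
      then obtain e' where "e = e' * q" by (auto simp: dvd_def mult.commute)
      then have "(c' * a) * q = (p * e') * q" using e c' by (simp add: mult_ac)
      then have "c' * a = p * e'" using q(1) by (auto simp: irreducible_def)
      then have "p dvd c' * a" by simp
      moreover have "degree_sum r c' < degree_sum r c"
        unfolding c' using less.prems q c' by (intro degree_sum_less) (auto simp: irreducible_def)
      moreover have "c' \<in> mpolys_in {..<r}" "c' \<in> mpolys_in V"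
        using mpolys_in_dvd[of c' c] c' less.prems by auto
      ultimately show ?thesis using less.hyps c'0 by blast
    qed
  qed
qed auto

text \<open>
  Over the fraction field of the coefficient ring the ideal would be principal; \<open>p\<close> is the primitive
  part of a nonzero element of least degree in the variable \<open>i\<close>, and pseudo-division avoids the
  fraction field altogether.
\<close>

lemma ideal_gcd:
  fixes I :: "'a::field mpoly set"
  assumes prime: "\<And>q :: 'a mpoly. q \<in> mpolys_in V \<Longrightarrow> irreducible q \<Longrightarrow> prime_in (mpolys_in V) q"
    and i: "i \<notin> V" and I: "I \<subseteq> mpolys_in (insert i V)" "f \<in> I" "f \<noteq> 0"
    and diff: "\<And>a b. a \<in> I \<Longrightarrow> b \<in> I \<Longrightarrow> a - b \<in> I"
    and mult: "\<And>a b. a \<in> I \<Longrightarrow> b \<in> mpolys_in (insert i V) \<Longrightarrow> b * a \<in> I"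
  obtains c p where "c \<in> mpolys_in V" "c \<noteq> 0" "p \<in> mpolys_in (insert i V)" "c * p \<in> I"
    "\<And>a. a \<in> I \<Longrightarrow> p dvd a"
proof -
  let ?W = "insert i V"
  obtain m where m: "m \<in> I" "m \<noteq> 0"
    and min: "\<And>a. a \<in> I \<Longrightarrow> a \<noteq> 0 \<Longrightarrow> degree (to_poly i m) \<le> degree (to_poly i a)"
    using ex_has_least_nat[of "\<lambda>a. a \<in> I \<and> a \<noteq> 0" f "\<lambda>a. degree (to_poly i a)"] I by blast
  obtain c p where c: "c \<in> mpolys_in V" "c \<noteq> 0" "m = c * p" "primitive_over V p"
    using primitive_over_exists[OF m(2)] by blast
  have p: "p \<in> mpolys_in ?W"
    using mpolys_in_dvd[of p m] c(3) m I(1) by auto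
  have "p dvd a" if a: "a \<in> I" for a
  proof -
    have aW: "a \<in> mpolys_in ?W" using a I by auto
    have mW: "m \<in> mpolys_in ?W" using m I by auto
    obtain d q rem where d: "d \<in> mpolys_in V" "d \<noteq> 0" "q \<in> mpolys_in ?W"
      "d * a = q * m + rem" "\<And>k. k \<ge> degree (to_poly i m) \<Longrightarrow> coeff (to_poly i rem) k = 0"
      by (rule pseudo_division[OF i mW m(2) aW]) blast
    have "rem = d * a - q * m" using d(4) by simp
    also have "\<dots> \<in> I"
      using d(3) a m mpolys_in_mono[OF d(1) subset_insertI] by (intro diff mult) simp_all
    finally have "rem \<in> I" .
    \<comment> \<open>Otherwise \<open>rem\<close> would be a nonzero element of \<open>I\<close> of
      smaller degree in \<open>i\<close> than \<open>m\<close>. With \<open>m = c * p\<close> this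
      leaves \<open>p dvd d * a\<close>, and primitivity of \<open>p\<close> removes
      \<open>d\<close>.\<close>
    have "rem = 0"
    proof (rule ccontr)
      assume "rem \<noteq> 0"
      then have "coeff (to_poly i rem) (degree (to_poly i rem)) \<noteq> 0" by simp
      then show False using d(5) min[OF \<open>rem \<in> I\<close> \<open>rem \<noteq> 0\<close>] by blast
    qed
    then have "p dvd d * a" using d(4) c(3) by simp
    show ?thesis
    proof (rule primitive_over_dvd_cancel[of V ?W p d a])
      show "prime_in (mpolys_in ?W) q" if "q \<in> mpolys_in V" "irreducible q" for q :: "'a mpoly"
        using prime_in_insert[OF that(1) i prime[OF that]] .
    qed (use c p d aW \<open>p dvd d * a\<close> in auto)
  qed
  then show ?thesis using that c p m(1) by blast
qed

text \<open>Induction on the number of variables. If \<open>p\<close> does not involve the new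
  variable, Gauss's lemma \<open>prime_in_insert\<close> applies; otherwise \<open>p\<close> is
  primitive over the old variables and a Bezout argument works. Over a field no constant is
  irreducible, which settles \<open>r = 0\<close>.\<close>

lemma irreducible_imp_prime_in:
  fixes p :: "'a::field mpoly"
  assumes "p \<in> mpolys_in {..<r}" "irreducible p"
  shows "prime_in (mpolys_in {..<r}) p"
  using assms
proof (induction r arbitrary: p)
  case 0
  then show ?case using is_unit_mpoly_iff[of p] by (auto simp: irreducible_def)
next
  case (Suc r)
  let ?V = "{..<r}" and ?W = "insert r {..<r}"
  have W: "{..<Suc r} = ?W" by auto
  have r: "r \<notin> ?V" by simp
  show ?case
  proof (cases "p \<in> mpolys_in ?V")
    case True
    then show ?thesis unfolding W using Suc.IH[OF True Suc.prems(2)] r by (intro prime_in_insert) auto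
  next
    case False
    have pW: "p \<in> mpolys_in ?W" using Suc.prems W by simp
    have p0: "p \<noteq> 0" using Suc.prems by (auto simp: irreducible_def)
    show ?thesis
      unfolding prime_in_def W
    proof (intro ballI impI)
      fix a b assume ab: "a \<in> mpolys_in ?W" "b \<in> mpolys_in ?W" and dvd: "p dvd a * b"
      \<comment> \<open>The gcd \<open>q\<close> of \<open>p\<close> and \<open>a\<close> is associated to \<open>p\<close>, so that \<open>p dvd a\<close>, or it is a unit. In the second case some
        nonzero \<open>c\<close> free of the variable \<open>r\<close> is a combination of \<open>p\<close> and \<open>a\<close>, hence \<open>p dvd c * b\<close>,
        and \<open>c\<close> cancels because \<open>p\<close> is primitive.\<close>
      define I where "I = {u * p + v * a | u v. u \<in> mpolys_in ?W \<and> v \<in> mpolys_in ?W}"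
      have I: "p \<in> I" "a \<in> I"
        unfolding I_def by (force intro: exI[of _ 1] exI[of _ 0])+
      have ImemI: "u * p + v * a \<in> I" if "u \<in> mpolys_in ?W" "v \<in> mpolys_in ?W" for u v
        using that unfolding I_def by blast
      obtain c q where c: "c \<in> mpolys_in ?V" "c \<noteq> 0" "q \<in> mpolys_in ?W" "c * q \<in> I"
        "\<And>f. f \<in> I \<Longrightarrow> q dvd f"
      proof (rule ideal_gcd[of ?V r I p])
        show "I \<subseteq> mpolys_in ?W"
          unfolding I_def using pW ab by (auto intro!: mpolys_in_add mpolys_in_mult)
        show "f - g \<in> I" if "f \<in> I" "g \<in> I" for f g
        proof -
          obtain u v u' v' where uv: "u \<in> mpolys_in ?W" "v \<in> mpolys_in ?W" "u' \<in> mpolys_in ?W" "v' \<in> mpolys_in ?W"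
            "f = u * p + v * a" "g = u' * p + v' * a"
            using \<open>f \<in> I\<close> \<open>g \<in> I\<close> unfolding I_def by blast
          have "f - g = (u - u') * p + (v - v') * a" by (simp add: uv algebra_simps)
          then show ?thesis using uv by (auto intro!: ImemI mpolys_in_diff)
        qed
        show "g * f \<in> I" if "f \<in> I" "g \<in> mpolys_in ?W" for f g
        proof -
          obtain u v where uv: "u \<in> mpolys_in ?W" "v \<in> mpolys_in ?W" "f = u * p + v * a"
            using \<open>f \<in> I\<close> unfolding I_def by blast
          have "g * f = (g * u) * p + (g * v) * a" by (simp add: uv algebra_simps)
          then show ?thesis using uv that by (auto intro!: ImemI mpolys_in_mult)
        qed
      qed (use Suc.IH r p0 I in blast)+
      obtain e where e: "p = q * e" using c(5)[OF I(1)] by auto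
      then have "e dvd 1 \<or> q dvd 1" using Suc.prems(2) unfolding irreducible_def by blast
      then show "p dvd a \<or> p dvd b"
      proof
        assume "e dvd 1"
        then obtain d where "1 = e * d" by auto
        then have "q = p * d" unfolding e by (metis mult.assoc mult_1_right)
        then have "p dvd q" by simp
        then show ?thesis using c(5)[OF I(2)] dvd_trans by blast
      next
        assume "q dvd 1"
        then obtain d where d: "1 = q * d" by auto
        obtain u v where uv: "u \<in> mpolys_in ?W" "v \<in> mpolys_in ?W" "c * q = u * p + v * a"
          using c(4) unfolding I_def by blast
        have "c * q * b = (u * b) * p + v * (a * b)" by (simp add: uv algebra_simps)
        then have "p dvd c * q * b" using dvd by simp
        then have "p dvd c * q * b * d" by (rule dvd_mult2)
        also have "c * q * b * d = c * b * (q * d)" by (simp add: mult_ac)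
        finally have "p dvd c * b" by (simp flip: d)
        \<comment> \<open>If \<open>p = s * t\<close> with \<open>s\<close> irreducible in the old
          variables, then \<open>t\<close> is a unit, and \<open>p\<close> itself would be free of
          the variable \<open>r\<close>.\<close>
        moreover have "primitive_over ?V p"
          unfolding primitive_over_def
        proof (intro ballI impI notI)
          fix s assume s: "s \<in> mpolys_in ?V" "irreducible s" "s dvd p"
          then obtain t where t: "p = s * t" by auto
          then have "t dvd 1" using Suc.prems(2) s by (auto simp: irreducible_def)
          then have "t \<in> mpolys_in ?V" using is_unit_mpoly_iff[of t] mpolys_in_mono by blast
          then show False using False s t by (auto intro: mpolys_in_mult)
        qed
        moreover have "prime_in (mpolys_in ?W) s" if "s \<in> mpolys_in ?V" "irreducible s" for s :: "'a mpoly"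
          using prime_in_insert[OF that(1) r] Suc.IH[OF that] by simp
        ultimately have "p dvd b"
          using primitive_over_dvd_cancel[of ?V ?W p c b] pW c ab by blast
        then show ?thesis ..
      qed
    qed
  qed
qed

text \<open>Any three polynomials together involve finitely many variables, so primality in the
  whole type reduces to primality in some \<open>mpolys_in {..<r}\<close>.\<close>

theorem irreducible_imp_prime_elem_mpoly:
  fixes p :: "'a::field mpoly"
  assumes "irreducible p"
  shows "prime_elem p"
proof (rule prime_elemI)
  fix a b assume dvd: "p dvd a * b"
  obtain r1 r2 r3 where "p \<in> mpolys_in {..<r1}" "a \<in> mpolys_in {..<r2}" "b \<in> mpolys_in {..<r3}"
    by (meson mpolys_in_finite_vars)
  moreover define r where "r = r1 + r2 + r3"
  ultimately have "p \<in> mpolys_in {..<r}" "a \<in> mpolys_in {..<r}" "b \<in> mpolys_in {..<r}"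
    by (auto elim!: mpolys_in_mono)
  then show "p dvd a \<or> p dvd b"
    using irreducible_imp_prime_in[of p r] assms dvd by (auto simp: prime_in_def)
qed (use assms in \<open>auto simp: irreducible_def\<close>)

text \<open>A substitute for the resultant that works for any finite family. The \<open>p\<close>
  obtained from the ideal generated by \<open>F\<close> divides all members, hence is a unit, and
  \<open>h = c * p\<close> lies in the ideal with \<open>c\<close> free of the variable
  \<open>r\<close>.\<close>

lemma elimination:
  fixes F :: "'a::field mpoly set"
  assumes F: "finite F" "F \<subseteq> mpolys_in {..<Suc r}" and f: "f \<in> F" "f \<noteq> 0"
    and coprime: "\<And>d. d \<in> mpolys_in {..<Suc r} \<Longrightarrow> (\<And>a. a \<in> F \<Longrightarrow> d dvd a) \<Longrightarrow> d dvd 1"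
  obtains h u where "h \<in> mpolys_in {..<r}" "h \<noteq> 0" "h = (\<Sum>a\<in>F. u a * a)"
    "\<And>a. a \<in> F \<Longrightarrow> u a \<in> mpolys_in {..<Suc r}"
proof -
  let ?V = "{..<r}" and ?W = "{..<Suc r}"
  have W: "?W = insert r ?V" by auto
  define I where "I = {(\<Sum>a\<in>F. u a * a) | u. \<forall>a\<in>F. u a \<in> mpolys_in ?W}"
  have FI: "a \<in> I" if "a \<in> F" for a
    unfolding I_def using that F(1)
    by (auto intro!: exI[of _ "\<lambda>b. if b = a then 1 else 0"] simp: if_distrib[of "\<lambda>x. x * _"] cong: if_cong)
  obtain c p where c: "c \<in> mpolys_in ?V" "c \<noteq> 0" "p \<in> mpolys_in ?W" "c * p \<in> I"
    "\<And>f. f \<in> I \<Longrightarrow> p dvd f"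
    unfolding W
  proof (rule ideal_gcd[of ?V r I f])
    show "I \<subseteq> mpolys_in (insert r ?V)"
      unfolding I_def W[symmetric] using F by (auto intro!: mpolys_in_sum mpolys_in_mult)
    show "f - g \<in> I" if "f \<in> I" "g \<in> I" for f g
    proof -
      obtain u v where uv: "\<forall>a\<in>F. u a \<in> mpolys_in ?W" "\<forall>a\<in>F. v a \<in> mpolys_in ?W"
        "f = (\<Sum>a\<in>F. u a * a)" "g = (\<Sum>a\<in>F. v a * a)"
        using \<open>f \<in> I\<close> \<open>g \<in> I\<close> unfolding I_def by blast
      have "f - g = (\<Sum>a\<in>F. (u a - v a) * a)" by (simp add: uv sum_subtractf left_diff_distrib)
      then show ?thesis unfolding I_def using uv by (auto intro!: exI[of _ "\<lambda>a. u a - v a"] mpolys_in_diff)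
    qed
    show "g * f \<in> I" if "f \<in> I" "g \<in> mpolys_in (insert r ?V)" for f g
    proof -
      obtain u where uv: "\<forall>a\<in>F. u a \<in> mpolys_in ?W" "f = (\<Sum>a\<in>F. u a * a)"
        using \<open>f \<in> I\<close> unfolding I_def by blast
      have "g * f = (\<Sum>a\<in>F. (g * u a) * a)" by (simp add: uv sum_distrib_left mult_ac)
      then show ?thesis unfolding I_def using uv that W by (auto intro!: exI[of _ "\<lambda>a. g * u a"] mpolys_in_mult)
    qed
    show "prime_in (mpolys_in ?V) q" if "q \<in> mpolys_in ?V" "irreducible q" for q :: "'a mpoly"
      using that by (rule irreducible_imp_prime_in)
  qed (use f FI in auto)
  have "p dvd 1" using coprime[OF c(3)] c(5) FI by blast
  then have p: "p \<noteq> 0" "p \<in> mpolys_in ?V"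
    using is_unit_mpoly_iff[of p] mpolys_in_mono[of p "{}" ?V] by auto
  obtain u where "\<forall>a\<in>F. u a \<in> mpolys_in ?W" "c * p = (\<Sum>a\<in>F. u a * a)"
    using c(4) unfolding I_def by blast
  moreover have "c * p \<in> mpolys_in ?V" "c * p \<noteq> 0" using c p by (auto intro: mpolys_in_mult)
  ultimately show ?thesis using that by blast
qed

section \<open>Counting points modulo primes\<close>

lemma finite_points: "finite S \<Longrightarrow> finite (points r S)"
  unfolding points_def by (intro finite_PiE) auto

lemma card_points: "card (points r S) = card S ^ r"
  unfolding points_def by (simp add: card_PiE)

lemma points_Suc: "points (Suc r) S = (\<lambda>(x, y). x(r := y)) ` (points r S \<times> S)"
  unfolding points_def lessThan_Suc PiE_insert_eq by force

lemma inj_on_points_update: "inj_on (\<lambda>(x, y). x(r := y)) (points r S \<times> T)"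
proof (intro inj_onI, clarsimp)
  fix x y x' y'
  assume x: "x \<in> points r S" "x' \<in> points r S" and eq: "x(r := y) = x'(r := y')"
  have "x i = x' i" for i
  proof (cases "i = r")
    case True
    then show ?thesis using x by (auto simp: points_def PiE_def extensional_def)
  next
    case False
    then show ?thesis using fun_cong[OF eq, of i] by simp
  qed
  then show "x = x' \<and> y = y'" using fun_cong[OF eq, of r] by auto
qed

lemma card_points_Suc:
  assumes "finite S"
  shows "card {n \<in> points (Suc r) S. Q n} = (\<Sum>x\<in>points r S. card {y \<in> S. Q (x(r := y))})"
proof -
  let ?Z = "SIGMA x:points r S. {y \<in> S. Q (x(r := y))}"
  have "{n \<in> points (Suc r) S. Q n} = (\<lambda>(x, y). x(r := y)) ` ?Z"
    unfolding points_Suc by auto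
  moreover have "inj_on (\<lambda>(x, y). x(r := y)) ?Z"
    by (rule inj_on_subset[OF inj_on_points_update[of r S S]]) auto
  ultimately have "card {n \<in> points (Suc r) S. Q n} = card ?Z"
    by (simp add: card_image)
  also have "\<dots> = (\<Sum>x\<in>points r S. card {y \<in> S. Q (x(r := y))})"
    using assms by (intro card_SigmaI) (auto simp: finite_points)
  finally show ?thesis .
qed

lemma sum_if_eq_card:
  "finite A \<Longrightarrow> (\<Sum>x\<in>A. if P x then c else 0) = real (card {x \<in> A. P x}) * c"
  by (simp add: sum.If_cases Int_def)

text \<open>Members of one class are separated by the quotient \<open>y div int p\<close>. The
  summand \<open>1\<close> dominates once \<open>p > B\<close>; divided by \<open>B\<close> it
  becomes the \<open>1 / real B\<close> in \<open>schwartz_zippel_mod_prime\<close>.\<close>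

lemma card_residue_class:
  assumes "p > 0"
  shows "real (card {y \<in> {0..<int B}. int p dvd y - a}) \<le> real B / real p + 1"
proof -
  let ?S = "{y \<in> {0..<int B}. int p dvd y - a}"
  have "inj_on (\<lambda>y. y div int p) ?S"
  proof (rule inj_onI)
    fix y z assume y: "y \<in> ?S" and z: "z \<in> ?S" and eq: "y div int p = z div int p"
    have "int p dvd (y - a) - (z - a)" by (rule dvd_diff) (use y z in auto)
    then have "y mod int p = z mod int p" by (simp add: mod_eq_dvd_iff)
    then show "y = z" using eq by (metis div_mult_mod_eq)
  qed
  then have "card ?S = card ((\<lambda>y. y div int p) ` ?S)" by (simp add: card_image)
  also have "\<dots> \<le> card {0..int (B div p)}"
    using assms by (intro card_mono) (auto simp: zdiv_int pos_imp_zdiv_nonneg_iff intro!: zdiv_mono1)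
  also have "\<dots> = B div p + 1" by simp
  finally have "real (card ?S) \<le> real (B div p) + 1" by linarith
  also have "real (B div p) \<le> real B / real p" by (rule of_nat_div_le_of_nat)
  finally show ?thesis by simp
qed

text \<open>Lagrange's bound, by splitting off one root \<open>a\<close> modulo \<open>p\<close>.
  The degree is that of the integer polynomial, so the leading coefficient may vanish modulo
  \<open>p\<close>; it is enough that some coefficient survives, and synthetic division at
  \<open>a\<close> preserves this.\<close>

lemma card_roots_mod_prime:
  fixes q :: "int poly"
  assumes "prime p" "\<not> int p dvd coeff q k"
  shows "real (card {y \<in> {0..<int B}. int p dvd poly q y}) \<le> real (degree q) * (real B / real p + 1)"
  using assms(2)
proof (induction "degree q" arbitrary: q k)
  case 0
  then obtain a where a: "q = [:a:]" by (metis degree_eq_zeroE)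
  have "\<not> int p dvd a" using 0 by (auto simp: a coeff_pCons split: nat.splits)
  then show ?case by (simp add: a)
next
  case (Suc d)
  let ?S = "{y \<in> {0..<int B}. int p dvd poly q y}"
  show ?case
  proof (cases "?S = {}")
    case True
    then show ?thesis unfolding True by simp
  next
    case False
    then obtain a where a: "int p dvd poly q a" by auto
    define q1 where "q1 = synthetic_div q a"
    \<comment> \<open>The remainder \<open>poly q a\<close> is divisible by \<open>p\<close> but
      need not be \<open>0\<close>, so it is carried along.\<close>
    have q: "q = [:- a, 1:] * q1 + [:poly q a:]"
      unfolding q1_def by (rule synthetic_div_correct'[symmetric])
    have deg: "d = degree q1" using Suc.hyps(2) by (simp add: q1_def degree_synthetic_div)
    have "\<exists>k. \<not> int p dvd coeff q1 k"
    proof (rule ccontr)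
      assume "\<not> ?thesis"
      then have "int p dvd coeff q k"
        using a by (subst q) (auto simp: coeff_pCons split: nat.splits)
      then show False using Suc.prems by simp
    qed
    then obtain k1 where k1: "\<not> int p dvd coeff q1 k1" by auto
    let ?A = "{y \<in> {0..<int B}. int p dvd y - a}" and ?B = "{y \<in> {0..<int B}. int p dvd poly q1 y}"
    have "?S \<subseteq> ?A \<union> ?B"
    proof
      fix y assume y: "y \<in> ?S"
      have "poly q y = (y - a) * poly q1 y + poly q a"
        by (subst q) (simp add: algebra_simps)
      then have "int p dvd (y - a) * poly q1 y"
        using y a by (metis (mono_tags, lifting) dvd_add_left_iff mem_Collect_eq)
      then show "y \<in> ?A \<union> ?B" using y assms(1) by (auto simp: prime_dvd_mult_iff)
    qed
    moreover have "finite (?A \<union> ?B)" by (rule finite_subset[of _ "{0..<int B}"]) auto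
    ultimately have "card ?S \<le> card (?A \<union> ?B)" by (intro card_mono)
    also have "\<dots> \<le> card ?A + card ?B" by (rule card_Un_le)
    finally have "real (card ?S) \<le> real (card ?A) + real (card ?B)" by linarith
    also have "\<dots> \<le> (real B / real p + 1) + real (degree q1) * (real B / real p + 1)"
      using card_residue_class[of p B a] Suc.hyps(1)[OF deg k1] assms(1) prime_gt_0_nat[of p]
      by (intro add_mono) auto
    also have "\<dots> = real (degree q) * (real B / real p + 1)"
      unfolding Suc.hyps(2)[symmetric] deg[symmetric] by (simp add: algebra_simps add_divide_distrib)
    finally show ?thesis .
  qed
qed

lemma coeff_to_poly_in_lessThan:
  "p \<in> mpolys_in {..<Suc r} \<Longrightarrow> coeff (to_poly r p) k \<in> mpolys_in {..<r}"
  using coeff_to_poly_in[of p "{..<Suc r}" r k] by (simp add: lessThan_Suc)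

lemma card_fibre_roots:
  assumes "prime p" "\<not> int p dvd mpoly_eval (coeff (to_poly r f) k) x"
  shows "real (card {y \<in> {0..<int B}. int p dvd mpoly_eval f (x(r := y))})
    \<le> real (degree (to_poly r f)) * (real B / real p + 1)"
proof -
  let ?q = "map_poly (\<lambda>c. mpoly_eval c x) (to_poly r f)"
  have "real (card {y \<in> {0..<int B}. int p dvd poly ?q y}) \<le> real (degree ?q) * (real B / real p + 1)"
    using assms by (intro card_roots_mod_prime[of p ?q k])
      (auto simp: coeff_map_poly ring_hom_0[OF ring_hom_mpoly_eval])
  also have "\<dots> \<le> real (degree (to_poly r f)) * (real B / real p + 1)"
    by (intro mult_right_mono) (auto simp: map_poly_degree_leq)
  finally show ?thesis by (simp add: mpoly_eval_to_poly)
qed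

text \<open>Induction by fibres in the last coordinate: over a zero modulo \<open>p\<close> of the
  leading coefficient \<open>g\<close> the whole fibre is counted, over any other point at most
  \<open>d * (B / p + 1)\<close> values. \<open>M\<close> excludes the primes dividing the integer
  constant left after all variables are removed, since modulo such primes \<open>f\<close> may
  vanish identically.\<close>

lemma schwartz_zippel_mod_prime:
  fixes f :: "int mpoly"
  assumes "f \<in> mpolys_in {..<r}" "f \<noteq> 0"
  obtains D :: real and M :: nat where "D \<ge> 0"
    "\<And>p B. prime p \<Longrightarrow> p > M \<Longrightarrow> B \<ge> 1 \<Longrightarrow>
      real (card {n \<in> points r {0..<int B}. int p dvd mpoly_eval f n}) \<le> D * real B ^ r * (1 / real p + 1 / real B)"
proof -
  have "\<exists>D\<ge>0. \<exists>M. \<forall>p B. prime p \<longrightarrow> p > M \<longrightarrow> B \<ge> 1 \<longrightarrow>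
      real (card {n \<in> points r {0..<int B}. int p dvd mpoly_eval f n}) \<le> D * real B ^ r * (1 / real p + 1 / real B)"
    using assms
  proof (induction r arbitrary: f)
    case 0
    then obtain a where a: "f = Const a" using mpolys_in_empty[of f] by auto
    with 0 have "a \<noteq> 0" by auto
    then have "\<not> int p dvd a" if "p > nat \<bar>a\<bar>" for p
      using that dvd_imp_le_int[of a "int p"] by auto
    then show ?case
      by (intro exI[of _ 0] conjI exI[of _ "nat \<bar>a\<bar>"]) (auto simp: a)
  next
    case (Suc r)
    define d where "d = degree (to_poly r f)"
    define g where "g = coeff (to_poly r f) d"
    have "g \<in> mpolys_in {..<r}" "g \<noteq> 0"
      using Suc.prems by (auto simp: g_def d_def coeff_to_poly_in_lessThan)
    from Suc.IH[OF this] obtain D M where D: "D \<ge> 0" and DM: "\<And>p B. prime p \<Longrightarrow> p > M \<Longrightarrow> B \<ge> 1 \<Longrightarrow>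
      real (card {n \<in> points r {0..<int B}. int p dvd mpoly_eval g n}) \<le> D * real B ^ r * (1 / real p + 1 / real B)"
      by blast
    have "real (card {n \<in> points (Suc r) {0..<int B}. int p dvd mpoly_eval f n})
        \<le> (D + d) * real B ^ Suc r * (1 / real p + 1 / real B)"
      if p: "prime p" "p > M" and B: "B \<ge> 1" for p B
    proof -
      let ?P = "points r {0..<int B}"
      have "real (card {n \<in> points (Suc r) {0..<int B}. int p dvd mpoly_eval f n})
        = (\<Sum>x\<in>?P. real (card {y \<in> {0..<int B}. int p dvd mpoly_eval f (x(r := y))}))"
        by (subst card_points_Suc) auto
      also have "\<dots> \<le> (\<Sum>x\<in>?P. (if int p dvd mpoly_eval g x then real B else 0) + d * (real B / real p + 1))"
      proof (rule sum_mono)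
        fix x assume "x \<in> ?P"
        show "real (card {y \<in> {0..<int B}. int p dvd mpoly_eval f (x(r := y))})
          \<le> (if int p dvd mpoly_eval g x then real B else 0) + d * (real B / real p + 1)"
        proof (cases "int p dvd mpoly_eval g x")
          case True
          have "card {y \<in> {0..<int B}. int p dvd mpoly_eval f (x(r := y))} \<le> card {0..<int B}"
            by (intro card_mono) auto
          then have "real (card {y \<in> {0..<int B}. int p dvd mpoly_eval f (x(r := y))}) \<le> real B" by simp
          also have "\<dots> \<le> real B + d * (real B / real p + 1)" by simp
          finally show ?thesis using True by simp
        next
          case False
          then show ?thesis using card_fibre_roots[of p r f d x B] p unfolding g_def d_def by simp
        qed
      qed
      also have "\<dots> = real (card {x \<in> ?P. int p dvd mpoly_eval g x}) * B + real (card ?P) * (d * (real B / real p + 1))"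
        by (simp add: sum.distrib sum_if_eq_card finite_points)
      also have "\<dots> \<le> (D * real B ^ r * (1 / real p + 1 / real B)) * B + real B ^ r * (d * (real B / real p + 1))"
        using DM[OF p B] by (intro add_mono mult_right_mono) (auto simp: card_points)
      also have "\<dots> = (D + d) * real B ^ Suc r * (1 / real p + 1 / real B)"
        using B prime_gt_0_nat[OF p(1)] by (simp add: field_simps)
      finally show ?thesis .
    qed
    then show ?case using D by (intro exI[of _ "D + d"] conjI exI[of _ M]) auto
  qed
  then show ?thesis using that by blast
qed

text \<open>An integer zero is a zero modulo every prime. For one prime \<open>p > max M B\<close>
  the bound \<open>DM\<close> applies and \<open>1 / real p \<le> 1 / real B\<close>, whence the
  factor \<open>2\<close>.\<close>

lemma card_zeros_le:
  fixes f :: "int mpoly"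
  assumes DM: "\<And>p B. prime p \<Longrightarrow> p > M \<Longrightarrow> B \<ge> 1 \<Longrightarrow>
      real (card {n \<in> points r {0..<int B}. int p dvd mpoly_eval f n}) \<le> D * real B ^ r * (1 / real p + 1 / real B)"
    and "D \<ge> 0" "B \<ge> 1"
  shows "real (card {n \<in> points r {0..<int B}. mpoly_eval f n = 0}) \<le> 2 * D * real B ^ r / real B"
proof -
  obtain p where p: "prime p" "p > max M B" using bigger_prime by blast
  have "real (card {n \<in> points r {0..<int B}. mpoly_eval f n = 0})
    \<le> real (card {n \<in> points r {0..<int B}. int p dvd mpoly_eval f n})"
    by (intro of_nat_mono card_mono) (auto simp: finite_points)
  also have "\<dots> \<le> D * real B ^ r * (1 / real p + 1 / real B)"
    using p assms by (intro DM) auto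
  also have "\<dots> \<le> D * real B ^ r * (1 / real B + 1 / real B)"
    using p assms by (intro mult_left_mono add_mono) (auto simp: field_simps)
  also have "\<dots> = 2 * D * real B ^ r / real B" by simp
  finally show ?thesis .
qed

text \<open>Crude but uniform: \<open>H\<close> is the sum of the absolute values of the
  coefficients, and \<open>e\<close> the sum of the degrees of all monomials, hence at least each of
  them. Polynomial growth in \<open>B\<close> is what bounds the number of prime divisors greater
  than \<open>B\<close>.\<close>

lemma mpoly_eval_bound:
  fixes f :: "int mpoly"
  assumes f: "f \<in> mpolys_in {..<r}"
  obtains H e :: nat where
    "\<And>n B. n \<in> points r {0..<int B} \<Longrightarrow> B \<ge> 1 \<Longrightarrow> \<bar>mpoly_eval f n\<bar> \<le> int (H * B ^ e)"
proof -
  define deg where "deg = (\<lambda>m::nat \<Rightarrow>\<^sub>0 nat. \<Sum>i\<in>Poly_Mapping.keys m. Poly_Mapping.lookup m i)"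
  define H where "H = (\<Sum>m\<in>Poly_Mapping.keys f. nat \<bar>Poly_Mapping.lookup f m\<bar>)"
  define e where "e = (\<Sum>m\<in>Poly_Mapping.keys f. deg m)"
  have "\<bar>mpoly_eval f n\<bar> \<le> int (H * B ^ e)"
    if n: "n \<in> points r {0..<int B}" and B: "B \<ge> 1" for n B
  proof -
    have "\<bar>mpoly_eval f n\<bar> \<le> (\<Sum>m\<in>Poly_Mapping.keys f. \<bar>Poly_Mapping.lookup f m\<bar> *
        (\<Prod>i\<in>Poly_Mapping.keys m. \<bar>n i\<bar> ^ Poly_Mapping.lookup m i))"
      unfolding mpoly_eval_def
      by (rule order_trans[OF sum_abs]) (simp add: abs_mult abs_prod power_abs)
    also have "\<dots> \<le> (\<Sum>m\<in>Poly_Mapping.keys f. \<bar>Poly_Mapping.lookup f m\<bar> * int B ^ e)"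
    proof (intro sum_mono mult_left_mono)
      fix m assume m: "m \<in> Poly_Mapping.keys f"
      have "\<bar>n i\<bar> \<le> int B" if "i \<in> Poly_Mapping.keys m" for i
      proof -
        have "i < r" using f m that by (auto simp: mpolys_in_def)
        then have "n i \<in> {0..<int B}" using n by (auto simp: points_def dest!: PiE_mem)
        then show ?thesis by simp
      qed
      then have "(\<Prod>i\<in>Poly_Mapping.keys m. \<bar>n i\<bar> ^ Poly_Mapping.lookup m i) \<le>
        (\<Prod>i\<in>Poly_Mapping.keys m. int B ^ Poly_Mapping.lookup m i)"
        by (intro prod_mono conjI power_mono) auto
      also have "\<dots> = int B ^ deg m" by (simp add: deg_def power_sum)
      also have "\<dots> \<le> int B ^ e"
        using B m unfolding e_def by (intro power_increasing member_le_sum) auto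
      finally show "(\<Prod>i\<in>Poly_Mapping.keys m. \<bar>n i\<bar> ^ Poly_Mapping.lookup m i) \<le> int B ^ e" .
    qed auto
    also have "\<dots> = int (H * B ^ e)" by (simp add: H_def sum_distrib_right)
    finally show ?thesis .
  qed
  then show ?thesis using that by blast
qed

lemma prod_primes_dvd_int:
  assumes "finite S" "\<And>p. p \<in> S \<Longrightarrow> prime p" "\<And>p. p \<in> S \<Longrightarrow> int p dvd x"
  shows "int (\<Prod>S) dvd x"
  using assms
proof (induction S rule: finite_induct)
  case (insert p S)
  have "coprime p (\<Prod>S)"
    using insert by (intro prod_coprime_right primes_coprime) auto
  then have "coprime (int p) (int (\<Prod>S))" by (simp only: coprime_int_iff)
  then have "int p * int (\<Prod>S) dvd x"
    using insert by (intro divides_mult) auto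
  then show ?case using insert by simp
qed auto

text \<open>If \<open>k\<close> distinct primes \<open>p > B\<close> divide \<open>x\<close>, then
  \<open>(B + 1) ^ k \<le> H * B ^ e\<close>, so any excess of \<open>k\<close> over
  \<open>e\<close> is at most the logarithm of \<open>H\<close> to base \<open>B + 1\<close>, which
  is at least \<open>2\<close>. The bound \<open>e + H\<close> is generous but independent of
  \<open>B\<close>.\<close>

lemma card_large_prime_divisors:
  fixes x :: int
  assumes "x \<noteq> 0" "\<bar>x\<bar> \<le> int (H * B ^ e)" "B \<ge> 1"
  shows "finite {p. prime p \<and> p > B \<and> int p dvd x}" "card {p. prime p \<and> p > B \<and> int p dvd x} \<le> e + H"
proof -
  let ?S = "{p. prime p \<and> p > B \<and> int p dvd x}"
  have "?S \<subseteq> {..nat \<bar>x\<bar>}"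
  proof
    fix p assume "p \<in> ?S"
    then have "\<bar>int p\<bar> \<le> \<bar>x\<bar>" using assms(1) by (intro dvd_imp_le_int) auto
    then show "p \<in> {..nat \<bar>x\<bar>}" by simp
  qed
  then show fin: "finite ?S" by (rule finite_subset) auto
  let ?k = "card ?S"
  have "(B + 1) ^ ?k = (\<Prod>p\<in>?S. B + 1)" by simp
  also have "\<dots> \<le> \<Prod>?S"
  proof (rule prod_mono)
    fix p assume "p \<in> ?S"
    then show "0 \<le> B + 1 \<and> B + 1 \<le> p" by simp
  qed
  finally have le1: "(B + 1) ^ ?k \<le> \<Prod>?S" .
  have "int (\<Prod>?S) dvd x" by (rule prod_primes_dvd_int[OF fin]) simp_all
  then have "\<bar>int (\<Prod>?S)\<bar> \<le> \<bar>x\<bar>" by (rule dvd_imp_le_int[OF assms(1)])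
  also note assms(2)
  finally have "\<Prod>?S \<le> H * B ^ e" by (simp only: abs_of_nat of_nat_le_iff)
  also have "\<dots> \<le> H * (B + 1) ^ e" by (intro mult_left_mono power_mono) auto
  finally have le: "(B + 1) ^ ?k \<le> H * (B + 1) ^ e" using le1 by (rule order_trans[rotated])
  show "?k \<le> e + H"
  proof (rule ccontr)
    assume k: "\<not> ?thesis"
    have "(B + 1) ^ (?k - e) * (B + 1) ^ e \<le> H * (B + 1) ^ e"
      using le k by (simp flip: power_add)
    then have "(B + 1) ^ (?k - e) \<le> H" by simp
    moreover have "2 ^ (?k - e) \<le> (B + 1) ^ (?k - e)" using assms(3) by (intro power_mono) auto
    moreover have "?k - e < 2 ^ (?k - e)" by (rule less_exp)
    ultimately show False using k by linarith
  qed
qed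

text \<open>Comparison with the telescoping series of \<open>1/n - 1/(n+1)\<close>. All integers are
  summed; the sum over primes is bounded by this one later.\<close>

lemma sum_inverse_squares_le:
  assumes "M \<ge> 1"
  shows "(\<Sum>p\<in>{M<..N}. 1 / real p ^ 2) \<le> 1 / real M"
proof -
  have "(\<Sum>p\<in>{M<..N}. 1 / real p ^ 2) \<le> 1 / real M - 1 / real N" if "M \<le> N"
    using that
  proof (induction N rule: dec_induct)
    case (step n)
    have "1 / real (Suc n) ^ 2 \<le> 1 / (real n * real (Suc n))"
      using assms step by (intro divide_left_mono) (auto simp: power2_eq_square)
    also have "\<dots> = 1 / real n - 1 / real (Suc n)" using assms step by (simp add: field_simps)
    finally have "(\<Sum>p\<in>{M<..n}. 1 / real p ^ 2) + 1 / real (Suc n) ^ 2 \<le> 1 / real M - 1 / real (Suc n)"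
      using step by simp
    moreover have "{M<..Suc n} = insert (Suc n) {M<..n}" using step by auto
    ultimately show ?case by simp
  qed auto
  moreover have "{M<..N} = {}" if "\<not> M \<le> N" using that by auto
  ultimately show ?thesis by (cases "M \<le> N") (auto intro: order_trans)
qed

section \<open>The contribution of large primes\<close>

text \<open>The definition asks for cofactors inside \<open>mpolys r\<close>, while
  \<open>dvd\<close> allows any. For a nonzero member \<open>mpolys_in_dvd\<close> places the
  cofactor there; for a zero member, which can occur in coefficient families, \<open>0\<close> is
  chosen.\<close>

lemma coprime_family_dvd:
  assumes "coprime_family r F" "F \<subseteq> mpolys_in {..<r}" "d \<in> mpolys_in {..<r}"
    and dvd: "\<And>a. a \<in> F \<Longrightarrow> d dvd rat_mpoly a"
  shows "d \<in> mpolys_in {}"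
proof (rule ccontr)
  assume "d \<notin> mpolys_in {}"
  then have "mpoly_degree d > 0" using mpoly_degree_eq_0_iff[of d] by simp
  moreover have "\<exists>e\<in>mpolys_in {..<r}. rat_mpoly a = d * e" if a: "a \<in> F" for a
  proof (cases "a = 0")
    case True
    then show ?thesis using mpolys_in_0 by (intro bexI[of _ 0]) auto
  next
    case False
    obtain e where e: "rat_mpoly a = d * e" using dvd[OF a] by auto
    have "e \<in> mpolys_in {..<r}"
    proof (rule mpolys_in_dvd[of e "rat_mpoly a"])
      show "e dvd rat_mpoly a" by (simp add: e)
    qed (use False a assms(2) in auto)
    then show ?thesis using e by blast
  qed
  ultimately show False
    using assms(1,3) unfolding coprime_family_def mpolys_eq by blast
qed

lemma coprime_familyI:
  assumes "\<And>d. d \<in> mpolys_in {..<r} \<Longrightarrow> (\<And>a. a \<in> F \<Longrightarrow> d dvd rat_mpoly a) \<Longrightarrow> d \<in> mpolys_in {}"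
  shows "coprime_family r F"
  unfolding coprime_family_def mpolys_eq
proof (intro notI, elim bexE conjE)
  fix d assume d: "d \<in> mpolys_in {..<r}" "0 < mpoly_degree d" "\<forall>a\<in>F. \<exists>e\<in>mpolys_in {..<r}. rat_mpoly a = d * e"
  have "d dvd rat_mpoly a" if "a \<in> F" for a
    using d(3) that by (metis dvd_triv_left)
  then have "d \<in> mpolys_in {}" using assms d(1) by blast
  then show False using d(2) mpoly_degree_eq_0_iff[of d] by simp
qed

text \<open>Multiplying the rational combination from \<open>elimination\<close> by a common
  denominator gives an integral combination of the members of \<open>F\<close>, so every common
  divisor of their values divides its value.\<close>

lemma elimination_int:
  fixes F :: "int mpoly set"
  assumes F: "finite F" "F \<subseteq> mpolys_in {..<Suc r}" and f: "f \<in> F" "f \<noteq> 0"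
    and coprime: "coprime_family (Suc r) F"
  obtains h where "h \<in> mpolys_in {..<r}" "h \<noteq> 0"
    "\<And>n q. (\<And>a. a \<in> F \<Longrightarrow> q dvd mpoly_eval a n) \<Longrightarrow> q dvd mpoly_eval h n"
proof -
  obtain h u where h: "h \<in> mpolys_in {..<r}" "h \<noteq> 0" "h = (\<Sum>a\<in>rat_mpoly ` F. u a * a)"
  proof (rule elimination[of "rat_mpoly ` F" r "rat_mpoly f"])
    show "d dvd 1" if "d \<in> mpolys_in {..<Suc r}" "\<And>a. a \<in> rat_mpoly ` F \<Longrightarrow> d dvd a" for d
    proof -
      have "d \<in> mpolys_in {}" using coprime_family_dvd[OF coprime F(2) that(1)] that(2) by blast
      moreover have "d \<noteq> 0" using that(2)[of "rat_mpoly f"] f by auto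
      ultimately show ?thesis by (simp add: is_unit_mpoly_iff)
    qed
  qed (use F f in \<open>auto intro!: that\<close>)
  have "\<exists>N q. N > 0 \<and> Const (rat_of_int N) * u (rat_mpoly a) = rat_mpoly q" for a
    using clear_denominators[of "u (rat_mpoly a)"] by metis
  then obtain N q where N: "\<And>a. N a > (0::int)"
    and q: "\<And>a. Const (rat_of_int (N a)) * u (rat_mpoly a) = rat_mpoly (q a)"
    by metis
  have rat_Const: "rat_mpoly (Const k) = Const (of_int k)" for k
    by (rule poly_mapping_eqI) (simp add: lookup_rat_mpoly lookup_single when_def del: single_of_int)
  \<comment> \<open>The cofactor of \<open>a\<close> has its own denominator \<open>N a\<close>; the
    product over \<open>F - {a}\<close> completes it to the common one, so that \<open>g\<close> is
    \<open>h\<close> times the product of all \<open>N b\<close>.\<close>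
  define g where "g = (\<Sum>a\<in>F. Const (\<Prod>b\<in>F - {a}. N b) * q a * a)"
  have "rat_mpoly g = (\<Sum>a\<in>F. Const (of_int (\<Prod>b\<in>F - {a}. N b)) * rat_mpoly (q a) * rat_mpoly a)"
    by (simp only: g_def ring_hom_sum[OF ring_hom_rat_mpoly] ring_hom_mult[OF ring_hom_rat_mpoly] rat_Const)
  also have "\<dots> = (\<Sum>a\<in>F. Const (of_int (\<Prod>b\<in>F. N b)) * (u (rat_mpoly a) * rat_mpoly a))"
  proof (rule sum.cong)
    fix a assume a: "a \<in> F"
    have "(\<Prod>b\<in>F. N b) = (\<Prod>b\<in>F - {a}. N b) * N a"
      using F a by (simp add: prod.remove mult.commute)
    then have "Const (rat_of_int (\<Prod>b\<in>F. N b)) = Const (of_int (\<Prod>b\<in>F - {a}. N b)) * Const (of_int (N a))"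
      by (simp add: mult_single del: single_of_int)
    then show "Const (of_int (\<Prod>b\<in>F - {a}. N b)) * rat_mpoly (q a) * rat_mpoly a =
        Const (of_int (\<Prod>b\<in>F. N b)) * (u (rat_mpoly a) * rat_mpoly a)"
      unfolding q[symmetric] by (simp only: mult_ac)
  qed simp
  also have "\<dots> = Const (of_int (\<Prod>b\<in>F. N b)) * h"
    unfolding h(3) by (subst sum.reindex) (auto intro: inj_on_subset[OF inj_rat_mpoly] simp: sum_distrib_left o_def)
  finally have g: "rat_mpoly g = Const (of_int (\<Prod>b\<in>F. N b)) * h" .
  have "(\<Prod>b\<in>F. N b) > 0" using N by (simp add: prod_pos)
  then have "Const (rat_of_int (\<Prod>b\<in>F. N b)) \<noteq> 0"
    by (metis lookup_single_eq lookup_zero of_int_0_eq_iff less_irrefl)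
  then have "rat_mpoly g \<noteq> 0" using h(2) unfolding g by simp
  then have "g \<noteq> 0" by simp
  moreover have "g \<in> mpolys_in {..<r}"
  proof -
    have "rat_mpoly g \<in> mpolys_in {..<r}"
      unfolding g using h(1) by (intro mpolys_in_mult mpolys_in_Const)
    then show ?thesis by simp
  qed
  moreover have "p dvd mpoly_eval g n" if "\<And>a. a \<in> F \<Longrightarrow> p dvd mpoly_eval a n" for n p
    unfolding g_def ring_hom_sum[OF ring_hom_mpoly_eval] ring_hom_mult[OF ring_hom_mpoly_eval]
    using that by (intro dvd_sum dvd_mult) auto
  ultimately show ?thesis using that by blast
qed

text \<open>At a point \<open>x\<close> the prime \<open>p\<close> divides all members of this
  family exactly when every member of \<open>F\<close>, restricted to the fibre over
  \<open>x\<close>, is the zero polynomial modulo \<open>p\<close>.\<close>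

definition coeff_family :: "nat \<Rightarrow> int mpoly set \<Rightarrow> int mpoly set" where
  "coeff_family r F = (\<Union>a\<in>F. (\<lambda>k. coeff (to_poly r a) k) ` {..degree (to_poly r a)})"

lemma coprime_coeff_family:
  assumes "coprime_family (Suc r) F" "F \<subseteq> mpolys_in {..<Suc r}"
  shows "coprime_family r (coeff_family r F)"
proof (rule coprime_familyI)
  fix d :: "rat mpoly" assume d: "d \<in> mpolys_in {..<r}" "\<And>a. a \<in> coeff_family r F \<Longrightarrow> d dvd rat_mpoly a"
  have "d dvd rat_mpoly a" if "a \<in> F" for a
  proof -
    have "rat_mpoly a = (\<Sum>k\<le>degree (to_poly r a). rat_mpoly (coeff (to_poly r a) k) * rat_mpoly (Var r ^ k))"
      by (subst mpoly_eq_sum_coeff[of a r])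
        (simp add: ring_hom_sum[OF ring_hom_rat_mpoly] ring_hom_mult[OF ring_hom_rat_mpoly])
    also have "d dvd \<dots>"
      using that d(2) by (intro dvd_sum dvd_mult2) (auto simp: coeff_family_def)
    finally show ?thesis .
  qed
  moreover have "d \<in> mpolys_in {..<Suc r}" using d(1) by (rule mpolys_in_mono) auto
  ultimately show "d \<in> mpolys_in {}" using coprime_family_dvd[OF assms] by blast
qed

text \<open>Members that vanish modulo \<open>p\<close> on the fibre do not restrict
  \<open>y\<close> and are left out. Allowing any surviving member costs the sum of the degrees in
  place of one degree, but avoids a choice depending on \<open>x\<close> and
  \<open>p\<close>.\<close>

lemma card_fibre_family_roots:
  assumes F: "finite F" and p: "prime p"
  shows "real (card {y \<in> {0..<int B}. \<exists>a\<in>F. (\<exists>k. \<not> int p dvd mpoly_eval (coeff (to_poly r a) k) x)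
      \<and> int p dvd mpoly_eval a (x(r := y))})
    \<le> real (\<Sum>a\<in>F. degree (to_poly r a)) * (real B / real p + 1)"
proof -
  let ?F = "{a \<in> F. \<exists>k. \<not> int p dvd mpoly_eval (coeff (to_poly r a) k) x}"
  let ?Y = "\<lambda>a. {y \<in> {0..<int B}. int p dvd mpoly_eval a (x(r := y))}"
  have "card {y \<in> {0..<int B}. \<exists>a\<in>F. (\<exists>k. \<not> int p dvd mpoly_eval (coeff (to_poly r a) k) x)
      \<and> int p dvd mpoly_eval a (x(r := y))} = card (\<Union>a\<in>?F. ?Y a)"
    by (rule arg_cong[of _ _ card]) auto
  also have "\<dots> \<le> (\<Sum>a\<in>?F. card (?Y a))" by (rule card_UN_le) (use F in auto)
  finally have "real (card {y \<in> {0..<int B}. \<exists>a\<in>F. (\<exists>k. \<not> int p dvd mpoly_eval (coeff (to_poly r a) k) x)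
      \<and> int p dvd mpoly_eval a (x(r := y))}) \<le> (\<Sum>a\<in>?F. real (card (?Y a)))"
    by (simp only: of_nat_sum[symmetric] of_nat_le_iff)
  also have "\<dots> \<le> (\<Sum>a\<in>?F. real (degree (to_poly r a)) * (real B / real p + 1))"
    using card_fibre_roots[OF p] by (intro sum_mono) blast
  also have "\<dots> \<le> (\<Sum>a\<in>F. real (degree (to_poly r a)) * (real B / real p + 1))"
    using F by (intro sum_mono2) auto
  finally show ?thesis by (simp add: sum_distrib_right)
qed

definition bad_points :: "nat \<Rightarrow> int mpoly set \<Rightarrow> nat \<Rightarrow> nat \<Rightarrow> (nat \<Rightarrow> int) set" where
  "bad_points r F M B =
    {n \<in> points r {0..<int B}. \<exists>p. prime p \<and> p > M \<and> (\<forall>a\<in>F. int p dvd mpoly_eval a n)}"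

text \<open>For \<open>M < p \<le> B\<close> the sums are exchanged: at most
  \<open>2 * D * B ^ r / p\<close> points have \<open>p\<close> dividing the value of
  \<open>h\<close>, each with weight at most \<open>2 * d * B / p\<close>, which gives
  \<open>4 * d * D\<close>. For \<open>p > B\<close> each point has at most \<open>e + H\<close>
  primes, of weight at most \<open>2 * d\<close>.\<close>

lemma sum_prime_divisor_fibres:
  fixes h :: "int mpoly" and D d :: real
  assumes D: "\<And>p. prime p \<Longrightarrow> p > M \<Longrightarrow>
      real (card {n \<in> points r {0..<int B}. int p dvd mpoly_eval h n}) \<le> D * real B ^ r * (1 / real p + 1 / real B)"
    and bound: "\<And>n. n \<in> points r {0..<int B} \<Longrightarrow> \<bar>mpoly_eval h n\<bar> \<le> int (H * B ^ e)"
    and nonneg: "D \<ge> 0" "d \<ge> 0" and M: "M \<ge> 1" and B: "B \<ge> 1"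
  shows "(\<Sum>x | x \<in> points r {0..<int B} \<and> mpoly_eval h x \<noteq> 0.
      \<Sum>p | prime p \<and> p > M \<and> int p dvd mpoly_eval h x. d * (real B / real p + 1))
    \<le> (4 * d * D + 2 * d * real (e + H)) * real B ^ Suc r * (1 / real M + 1 / real B)"
proof -
  let ?P = "{x. x \<in> points r {0..<int B} \<and> mpoly_eval h x \<noteq> 0}"
  let ?t = "\<lambda>p. d * (real B / real p + 1)"
  have finP: "finite ?P" by (rule finite_subset[of _ "points r {0..<int B}"]) (auto simp: finite_points)
  have inner: "(\<Sum>p | prime p \<and> p > M \<and> int p dvd mpoly_eval h x. ?t p)
      \<le> (\<Sum>p | prime p \<and> p \<in> {M<..B}. if int p dvd mpoly_eval h x then 2 * d * real B / real p else 0)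
        + real (e + H) * (2 * d)" if x: "x \<in> ?P" for x
  proof -
    let ?L = "{p. prime p \<and> p > B \<and> int p dvd mpoly_eval h x}"
    let ?S = "{p. prime p \<and> p \<in> {M<..B} \<and> int p dvd mpoly_eval h x}"
    have L: "finite ?L" "card ?L \<le> e + H"
      using card_large_prime_divisors[of "mpoly_eval h x" H B e] x bound B by auto
    have S: "finite ?S" by (rule finite_subset[of _ "{..B}"]) auto
    have "(\<Sum>p | prime p \<and> p > M \<and> int p dvd mpoly_eval h x. ?t p) \<le> (\<Sum>p\<in>?S \<union> ?L. ?t p)"
      using L S nonneg by (intro sum_mono2) auto
    also have "\<dots> = (\<Sum>p\<in>?S. ?t p) + (\<Sum>p\<in>?L. ?t p)"
      using L S by (intro sum.union_disjoint) auto
    also have "(\<Sum>p\<in>?S. ?t p) \<le> (\<Sum>p\<in>?S. 2 * d * real B / real p)"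
    proof (intro sum_mono)
      fix p assume p: "p \<in> ?S"
      then have "real p > 0" "1 \<le> real B / real p" using prime_gt_0_nat[of p] by (auto simp: field_simps)
      then have "?t p \<le> d * (real B / real p + real B / real p)"
        using nonneg by (intro mult_left_mono add_left_mono)
      also have "\<dots> = 2 * d * real B / real p" by simp
      finally show "?t p \<le> 2 * d * real B / real p" .
    qed
    also have "\<dots> = (\<Sum>p | prime p \<and> p \<in> {M<..B}. if int p dvd mpoly_eval h x then 2 * d * real B / real p else 0)"
      by (rule sum.mono_neutral_cong_left) (auto intro: finite_subset[of _ "{..B}"])
    also have "(\<Sum>p\<in>?L. ?t p) \<le> (\<Sum>p\<in>?L. 2 * d)"
    proof (intro sum_mono)
      fix p assume "p \<in> ?L"
      then have "real B / real p \<le> 1" by simp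
      then have "d * (real B / real p + 1) \<le> d * (1 + 1)"
        using nonneg by (intro mult_left_mono) auto
      then show "?t p \<le> 2 * d" by simp
    qed
    also have "\<dots> = real (card ?L) * (2 * d)" by simp
    also have "\<dots> \<le> real (e + H) * (2 * d)"
      using L(2) nonneg by (intro mult_right_mono) (auto simp del: of_nat_add)
    finally show ?thesis by (simp add: add_mono)
  qed
  have "(\<Sum>x\<in>?P. \<Sum>p | prime p \<and> p > M \<and> int p dvd mpoly_eval h x. ?t p)
    \<le> (\<Sum>x\<in>?P. (\<Sum>p | prime p \<and> p \<in> {M<..B}. if int p dvd mpoly_eval h x then 2 * d * real B / real p else 0)
        + real (e + H) * (2 * d))"
    by (intro sum_mono inner)
  also have "\<dots> = (\<Sum>p | prime p \<and> p \<in> {M<..B}. \<Sum>x\<in>?P. if int p dvd mpoly_eval h x then 2 * d * real B / real p else 0)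
      + real (card ?P) * (real (e + H) * (2 * d))"
    unfolding sum.distrib by (subst sum.swap) simp
  also have "(\<Sum>p | prime p \<and> p \<in> {M<..B}. \<Sum>x\<in>?P. if int p dvd mpoly_eval h x then 2 * d * real B / real p else 0)
    \<le> (\<Sum>p | prime p \<and> p \<in> {M<..B}. 4 * d * D * real B ^ Suc r * (1 / real p ^ 2))"
  proof (intro sum_mono)
    fix p assume p: "p \<in> {p. prime p \<and> p \<in> {M<..B}}"
    then have p0: "real p > 0" by (auto simp: prime_gt_0_nat)
    have "(\<Sum>x\<in>?P. if int p dvd mpoly_eval h x then 2 * d * real B / real p else 0)
      = real (card {x \<in> ?P. int p dvd mpoly_eval h x}) * (2 * d * real B / real p)"
      by (rule sum_if_eq_card[OF finP])
    also have "\<dots> \<le> (D * real B ^ r * (1 / real p + 1 / real p)) * (2 * d * real B / real p)"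
    proof (rule mult_right_mono)
      have "card {x \<in> ?P. int p dvd mpoly_eval h x} \<le> card {n \<in> points r {0..<int B}. int p dvd mpoly_eval h n}"
        by (intro card_mono) (auto simp: finite_points)
      then have "real (card {x \<in> ?P. int p dvd mpoly_eval h x}) \<le> D * real B ^ r * (1 / real p + 1 / real B)"
        using D[of p] p by force
      also have "\<dots> \<le> D * real B ^ r * (1 / real p + 1 / real p)"
        using p p0 nonneg by (intro mult_left_mono add_mono) (auto simp: field_simps)
      finally show "real (card {x \<in> ?P. int p dvd mpoly_eval h x}) \<le> D * real B ^ r * (1 / real p + 1 / real p)" .
    qed (use nonneg in auto)
    also have "\<dots> = 4 * d * D * real B ^ Suc r * (1 / real p ^ 2)"
      using p0 by (simp add: field_simps power2_eq_square)
    finally show "(\<Sum>x\<in>?P. if int p dvd mpoly_eval h x then 2 * d * real B / real p else 0)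
      \<le> 4 * d * D * real B ^ Suc r * (1 / real p ^ 2)" .
  qed
  also have "\<dots> = 4 * d * D * real B ^ Suc r * (\<Sum>p | prime p \<and> p \<in> {M<..B}. 1 / real p ^ 2)"
    by (simp only: sum_distrib_left)
  also have "\<dots> \<le> 4 * d * D * real B ^ Suc r * (1 / real M)"
  proof (rule mult_left_mono)
    have "(\<Sum>p | prime p \<and> p \<in> {M<..B}. 1 / real p ^ 2) \<le> (\<Sum>p\<in>{M<..B}. 1 / real p ^ 2)"
      by (intro sum_mono2) auto
    also have "\<dots> \<le> 1 / real M" using M by (rule sum_inverse_squares_le)
    finally show "(\<Sum>p | prime p \<and> p \<in> {M<..B}. 1 / real p ^ 2) \<le> 1 / real M" .
  qed (use nonneg in auto)
  also have "real (card ?P) * (real (e + H) * (2 * d)) \<le> real B ^ r * (real (e + H) * (2 * d))"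
  proof (rule mult_right_mono)
    have "card ?P \<le> card (points r {0..<int B})" by (intro card_mono) (auto simp: finite_points)
    then show "real (card ?P) \<le> real B ^ r"
      by (simp add: card_points flip: of_nat_power)
  qed (use nonneg in auto)
  also have "real B ^ r * (real (e + H) * (2 * d)) = 2 * d * real (e + H) * real B ^ Suc r * (1 / real B)"
    using B by simp
  \<comment> \<open>The product on the right contains two further mixed terms, which are
    nonnegative.\<close>
  also have "4 * d * D * real B ^ Suc r * (1 / real M) + 2 * d * real (e + H) * real B ^ Suc r * (1 / real B)
    \<le> (4 * d * D + 2 * d * real (e + H)) * real B ^ Suc r * (1 / real M + 1 / real B)"
  proof -
    have "(4 * d * D + 2 * d * real (e + H)) * real B ^ Suc r * (1 / real M + 1 / real B)
      = 4 * d * D * real B ^ Suc r * (1 / real M) + 2 * d * real (e + H) * real B ^ Suc r * (1 / real B)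
        + (4 * d * D * real B ^ Suc r * (1 / real B) + 2 * d * real (e + H) * real B ^ Suc r * (1 / real M))"
      by (simp only: algebra_simps)
    moreover have "0 \<le> 4 * d * D * real B ^ Suc r * (1 / real B) + 2 * d * real (e + H) * real B ^ Suc r * (1 / real M)"
      using nonneg by simp
    ultimately show ?thesis by linarith
  qed
  finally show ?thesis by (simp add: add_mono)
qed

text \<open>A bad point is charged to one of three causes: its projection \<open>x\<close> is bad
  for the coefficient family, \<open>h\<close> vanishes at \<open>x\<close>, or some
  \<open>p > M\<close> divides the nonzero value of \<open>h\<close> while a member of
  \<open>F\<close> survives modulo \<open>p\<close> on the fibre. \<open>F\<close> may contain
  \<open>0\<close>, as coefficient families can.\<close>

lemma tail_bound:
  fixes F :: "int mpoly set"
  assumes "finite F" "F \<subseteq> mpolys_in {..<r}" "\<not> F \<subseteq> {0}" "coprime_family r F"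
  obtains C :: real and M\<^sub>0 where "C \<ge> 0"
    "\<And>M B. M \<ge> M\<^sub>0 \<Longrightarrow> B \<ge> 1 \<Longrightarrow> real (card (bad_points r F M B)) \<le> C * real B ^ r * (1 / real M + 1 / real B)"
proof -
  have "\<exists>C\<ge>0. \<exists>M\<^sub>0. \<forall>M B. M \<ge> M\<^sub>0 \<longrightarrow> B \<ge> 1 \<longrightarrow>
      real (card (bad_points r F M B)) \<le> C * real B ^ r * (1 / real M + 1 / real B)"
    using assms
  proof (induction r arbitrary: F)
    case 0
    then obtain f where f: "f \<in> F" "f \<noteq> 0" by auto
    then obtain a where a: "f = Const a" using mpolys_in_empty[of f] 0 by auto
    with f have "a \<noteq> 0" by auto
    then have nd: "\<not> int p dvd a" if "p > nat \<bar>a\<bar>" for p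
      using that dvd_imp_le_int[of a "int p"] by auto
    have "bad_points 0 F M B = {}" if M: "M \<ge> nat \<bar>a\<bar>" for M B
    proof (rule ccontr)
      assume "bad_points 0 F M B \<noteq> {}"
      then obtain n p where "p > M" "int p dvd mpoly_eval f n"
        using f unfolding bad_points_def by blast
      then show False using nd[of p] M by (simp add: a)
    qed
    then show ?case by (intro exI[of _ 0] conjI exI[of _ "nat \<bar>a\<bar>"]) auto
  next
    case (Suc r)
    obtain f where f: "f \<in> F" "f \<noteq> 0" using Suc.prems by auto
    let ?F = "coeff_family r F"
    have "finite ?F" using Suc.prems by (simp add: coeff_family_def)
    moreover have "?F \<subseteq> mpolys_in {..<r}"
      using Suc.prems by (auto simp: coeff_family_def intro!: coeff_to_poly_in_lessThan)
    moreover have "coeff (to_poly r f) (degree (to_poly r f)) \<in> ?F"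
      using f by (auto simp: coeff_family_def)
    then have "\<not> ?F \<subseteq> {0}" using f by force
    moreover have "coprime_family r ?F"
      using Suc.prems by (intro coprime_coeff_family)
    ultimately have "\<exists>C\<ge>0. \<exists>M\<^sub>0. \<forall>M B. M \<ge> M\<^sub>0 \<longrightarrow> B \<ge> 1 \<longrightarrow>
      real (card (bad_points r ?F M B)) \<le> C * real B ^ r * (1 / real M + 1 / real B)"
      by (rule Suc.IH)
    then obtain C M\<^sub>1 where C: "C \<ge> 0" and CM: "\<And>M B. M \<ge> M\<^sub>1 \<Longrightarrow> B \<ge> 1 \<Longrightarrow>
      real (card (bad_points r ?F M B)) \<le> C * real B ^ r * (1 / real M + 1 / real B)"
      by blast
    obtain h where h: "h \<in> mpolys_in {..<r}" "h \<noteq> 0"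
      and elim: "\<And>n q. (\<And>a. a \<in> F \<Longrightarrow> q dvd mpoly_eval a n) \<Longrightarrow> q dvd mpoly_eval h n"
      using elimination_int[OF Suc.prems(1,2) f Suc.prems(4)] by blast
    obtain D M\<^sub>2 where D: "D \<ge> 0" and DM: "\<And>p B. prime p \<Longrightarrow> p > M\<^sub>2 \<Longrightarrow> B \<ge> 1 \<Longrightarrow>
      real (card {n \<in> points r {0..<int B}. int p dvd mpoly_eval h n}) \<le> D * real B ^ r * (1 / real p + 1 / real B)"
      using schwartz_zippel_mod_prime[OF h] by blast
    obtain H e where He: "\<And>n B. n \<in> points r {0..<int B} \<Longrightarrow> B \<ge> 1 \<Longrightarrow> \<bar>mpoly_eval h n\<bar> \<le> int (H * B ^ e)"
      by (rule mpoly_eval_bound[OF h(1)]) (rule that, simp)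
    define d where "d = real (\<Sum>a\<in>F. degree (to_poly r a))"
    have d: "d \<ge> 0" unfolding d_def by (rule of_nat_0_le_iff)
    \<comment> \<open>\<open>C\<close> pays for the bad points of the coefficient family,
      \<open>2 * D\<close> for the zeros of \<open>h\<close>, and the rest comes from
      \<open>sum_prime_divisor_fibres\<close>.\<close>
    define C' where "C' = C + 2 * D + (4 * d * D + 2 * d * real (e + H))"
    have "real (card (bad_points (Suc r) F M B)) \<le> C' * real B ^ Suc r * (1 / real M + 1 / real B)"
      if M: "M \<ge> max (max M\<^sub>1 M\<^sub>2) 1" and B: "B \<ge> 1" for M B
    proof -
      let ?P = "points r {0..<int B}"
      let ?R = "\<lambda>x p. {y \<in> {0..<int B}. \<exists>a\<in>F. (\<exists>k. \<not> int p dvd mpoly_eval (coeff (to_poly r a) k) x)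
        \<and> int p dvd mpoly_eval a (x(r := y))}"
      let ?A = "\<lambda>x. {p. prime p \<and> p > M \<and> int p dvd mpoly_eval h x}"
      let ?t = "\<lambda>x. \<Sum>p\<in>?A x. d * (real B / real p + 1)"
      have fibre: "real (card {y \<in> {0..<int B}. x(r := y) \<in> bad_points (Suc r) F M B})
        \<le> (if x \<in> bad_points r ?F M B then real B else 0)
          + (if mpoly_eval h x = 0 then real B else 0) + (if mpoly_eval h x \<noteq> 0 then ?t x else 0)"
        if x: "x \<in> ?P" for x
      proof (cases "x \<in> bad_points r ?F M B \<or> mpoly_eval h x = 0")
        case True
        have "card {y \<in> {0..<int B}. x(r := y) \<in> bad_points (Suc r) F M B} \<le> card {0..<int B}"
          by (intro card_mono) auto
        then have "real (card {y \<in> {0..<int B}. x(r := y) \<in> bad_points (Suc r) F M B}) \<le> real B" by simp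
        moreover have "?t x \<ge> 0" using d by (intro sum_nonneg) auto
        ultimately show ?thesis using True by auto
      next
        case False
        \<comment> \<open>As \<open>M \<ge> 1\<close>, \<open>card_large_prime_divisors\<close> with
          \<open>B = 1\<close>, \<open>e = 0\<close> and \<open>H\<close> the absolute value of
          \<open>h\<close> at \<open>x\<close> gives finiteness.\<close>
        have fin: "finite (?A x)"
        proof (rule finite_subset)
          show "finite {p. prime p \<and> p > 1 \<and> int p dvd mpoly_eval h x}"
            using False by (intro card_large_prime_divisors(1)[of _ "nat \<bar>mpoly_eval h x\<bar>" 1 0]) simp_all
        qed (use M in auto)
        have "{y \<in> {0..<int B}. x(r := y) \<in> bad_points (Suc r) F M B} \<subseteq> (\<Union>p\<in>?A x. ?R x p)"
        proof clarify
          fix y assume y: "y \<in> {0..<int B}" and "x(r := y) \<in> bad_points (Suc r) F M B"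
          then obtain p where p: "prime p" "p > M" "\<And>a. a \<in> F \<Longrightarrow> int p dvd mpoly_eval a (x(r := y))"
            unfolding bad_points_def by blast
          have "mpoly_eval h (x(r := y)) = mpoly_eval h x"
            by (rule mpoly_eval_cong[OF h(1)]) auto
          then have "int p dvd mpoly_eval h x" using elim[of "int p" "x(r := y)"] p(3) by simp
          moreover have "\<exists>a\<in>F. \<exists>k. \<not> int p dvd mpoly_eval (coeff (to_poly r a) k) x"
          proof (rule ccontr)
            assume "\<not> ?thesis"
            then have "\<forall>a\<in>?F. int p dvd mpoly_eval a x" by (auto simp: coeff_family_def)
            then show False using False x p by (auto simp: bad_points_def)
          qed
          ultimately show "y \<in> (\<Union>p\<in>?A x. ?R x p)" using y p by blast
        qed
        then have "card {y \<in> {0..<int B}. x(r := y) \<in> bad_points (Suc r) F M B} \<le> card (\<Union>p\<in>?A x. ?R x p)"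
        proof (rule card_mono[rotated])
          have "finite (?R x p)" for p by (rule finite_subset[of _ "{0..<int B}"]) auto
          then show "finite (\<Union>p\<in>?A x. ?R x p)" using fin by blast
        qed
        also have "\<dots> \<le> (\<Sum>p\<in>?A x. card (?R x p))" by (rule card_UN_le[OF fin])
        finally have "real (card {y \<in> {0..<int B}. x(r := y) \<in> bad_points (Suc r) F M B})
            \<le> (\<Sum>p\<in>?A x. real (card (?R x p)))"
          by (simp only: of_nat_sum[symmetric] of_nat_le_iff)
        also have "\<dots> \<le> ?t x"
          unfolding d_def using card_fibre_family_roots[OF Suc.prems(1)] by (intro sum_mono) blast
        finally show ?thesis using False by simp
      qed
      have "bad_points (Suc r) F M B = {n \<in> points (Suc r) {0..<int B}. n \<in> bad_points (Suc r) F M B}"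
        by (auto simp: bad_points_def)
      then have "real (card (bad_points (Suc r) F M B))
        = (\<Sum>x\<in>?P. real (card {y \<in> {0..<int B}. x(r := y) \<in> bad_points (Suc r) F M B}))"
        using card_points_Suc[of "{0..<int B}" r "\<lambda>n. n \<in> bad_points (Suc r) F M B"] by simp
      also have "\<dots> \<le> (\<Sum>x\<in>?P. (if x \<in> bad_points r ?F M B then real B else 0)
          + (if mpoly_eval h x = 0 then real B else 0) + (if mpoly_eval h x \<noteq> 0 then ?t x else 0))"
        by (intro sum_mono fibre)
      also have "\<dots> = real (card {x \<in> ?P. x \<in> bad_points r ?F M B}) * B
          + real (card {x \<in> ?P. mpoly_eval h x = 0}) * B + (\<Sum>x | x \<in> ?P \<and> mpoly_eval h x \<noteq> 0. ?t x)"
        by (simp only: sum.distrib sum_if_eq_card finite_points finite_atLeastLessThan_int)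
          (simp add: sum.inter_filter finite_points)
      also have "\<dots> \<le> (C * real B ^ r * (1 / real M + 1 / real B)) * B + (2 * D * real B ^ r / real B) * B
          + (4 * d * D + 2 * d * real (e + H)) * real B ^ Suc r * (1 / real M + 1 / real B)"
      proof (intro add_mono mult_right_mono)
        have "{x \<in> ?P. x \<in> bad_points r ?F M B} = bad_points r ?F M B"
          by (auto simp: bad_points_def)
        then show "real (card {x \<in> ?P. x \<in> bad_points r ?F M B}) \<le> C * real B ^ r * (1 / real M + 1 / real B)"
          using CM[of M B] M B by simp
        show "real (card {x \<in> ?P. mpoly_eval h x = 0}) \<le> 2 * D * real B ^ r / real B"
          by (rule card_zeros_le[OF DM D B])
        show "(\<Sum>x | x \<in> ?P \<and> mpoly_eval h x \<noteq> 0. ?t x)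
          \<le> (4 * d * D + 2 * d * real (e + H)) * real B ^ Suc r * (1 / real M + 1 / real B)"
          by (rule sum_prime_divisor_fibres) (use DM He M B D d in auto)
      qed auto
      also have "\<dots> \<le> C' * real B ^ Suc r * (1 / real M + 1 / real B)"
      proof -
        have "C' * real B ^ Suc r * (1 / real M + 1 / real B) = (C * real B ^ r * (1 / real M + 1 / real B)) * B
            + (2 * D * real B ^ r / real B) * B + 2 * D * real B ^ Suc r / real M
            + (4 * d * D + 2 * d * real (e + H)) * real B ^ Suc r * (1 / real M + 1 / real B)"
          using B M unfolding C'_def by (simp add: field_simps)
        moreover have "2 * D * real B ^ Suc r / real M \<ge> 0" using D by simp
        ultimately show ?thesis by linarith
      qed
      finally show ?thesis .
    qed
    moreover have "C' \<ge> 0" using C D d by (simp add: C'_def)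
    ultimately show ?case by blast
  qed
  then show ?thesis using that by blast
qed

section \<open>Periodic sets and density\<close>

text \<open>Quantifies over all functions, not only over \<open>points\<close>, so that congruence
  of the coordinates below \<open>r\<close> suffices and no membership has to be checked when points
  are shifted or reduced.\<close>

definition periodic :: "nat \<Rightarrow> nat \<Rightarrow> ((nat \<Rightarrow> int) \<Rightarrow> bool) \<Rightarrow> bool" where
  "periodic r m Q \<longleftrightarrow> (\<forall>n n'. (\<forall>i<r. [n i = n' i] (mod int m)) \<longrightarrow> Q n = Q n')"

definition reduce :: "nat \<Rightarrow> nat \<Rightarrow> (nat \<Rightarrow> int) \<Rightarrow> nat \<Rightarrow> int" where
  "reduce r m n = (\<lambda>i\<in>{..<r}. n i mod int m)"

lemma reduce_in_points: "m > 0 \<Longrightarrow> reduce r m n \<in> points r {0..<int m}"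
  by (auto simp: reduce_def points_def)

lemma reduce_cong: "i < r \<Longrightarrow> [reduce r m n i = n i] (mod int m)"
  by (simp add: reduce_def cong_def)

lemma periodic_reduce: "periodic r m Q \<Longrightarrow> Q (reduce r m n) = Q n"
  unfolding periodic_def using reduce_cong by blast

lemma points_nth: "n \<in> points r S \<Longrightarrow> i < r \<Longrightarrow> n i \<in> S"
  by (auto simp: points_def dest!: PiE_mem)

lemma points_eqI:
  assumes "n \<in> points r S" "n' \<in> points r T" "\<And>i. i < r \<Longrightarrow> n i = n' i"
  shows "n = n'"
proof
  fix i show "n i = n' i"
    using assms by (cases "i < r") (auto simp: points_def PiE_def extensional_def)
qed

text \<open>The Chinese remainder theorem in each coordinate: residue vectors modulo
  \<open>m1 * m2\<close> correspond to pairs of residue vectors, and by periodicity each condition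
  sees only its own component.\<close>

lemma card_points_crt:
  assumes m: "coprime m1 m2" "m1 > 0" "m2 > 0" and Q1: "periodic r m1 Q1" and Q2: "periodic r m2 Q2"
  shows "card {n \<in> points r {0..<int (m1 * m2)}. Q1 n \<and> Q2 n} =
    card {n \<in> points r {0..<int m1}. Q1 n} * card {n \<in> points r {0..<int m2}. Q2 n}"
proof -
  let ?A = "{n \<in> points r {0..<int (m1 * m2)}. Q1 n \<and> Q2 n}"
  let ?B = "{n \<in> points r {0..<int m1}. Q1 n} \<times> {n \<in> points r {0..<int m2}. Q2 n}"
  have cop: "coprime (int m1) (int m2)" using m(1) by simp
  have "bij_betw (\<lambda>n. (reduce r m1 n, reduce r m2 n)) ?A ?B"
  proof (rule bij_betwI')
    fix n n' assume n: "n \<in> ?A" "n' \<in> ?A"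
    show "(reduce r m1 n, reduce r m2 n) = (reduce r m1 n', reduce r m2 n') \<longleftrightarrow> n = n'"
    proof
      assume eq: "(reduce r m1 n, reduce r m2 n) = (reduce r m1 n', reduce r m2 n')"
      show "n = n'"
      proof (rule points_eqI)
        show "n \<in> points r {0..<int (m1 * m2)}" "n' \<in> points r {0..<int (m1 * m2)}" using n by auto
        fix i assume i: "i < r"
        have "[n i = n' i] (mod int m1)" "[n i = n' i] (mod int m2)"
          using eq reduce_cong[OF i] by (metis cong_sym cong_trans prod.inject)+
        then have "[n i = n' i] (mod int (m1 * m2))"
          using cop by (simp add: coprime_cong_mult)
        moreover have "n i \<in> {0..<int (m1 * m2)}" "n' i \<in> {0..<int (m1 * m2)}"
          using n i points_nth[of _ r "{0..<int (m1 * m2)}" i] by blast+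
        ultimately show "n i = n' i" by (simp add: cong_def)
      qed
    qed simp
  next
    fix n assume n: "n \<in> ?A"
    then show "(reduce r m1 n, reduce r m2 n) \<in> ?B"
      using m by (simp add: reduce_in_points periodic_reduce[OF Q1] periodic_reduce[OF Q2])
  next
    fix z assume "z \<in> ?B"
    then obtain u v where z: "z = (u, v)" and u: "u \<in> points r {0..<int m1}" "Q1 u"
      and v: "v \<in> points r {0..<int m2}" "Q2 v" by blast
    have "\<exists>x. [x = u i] (mod int m1) \<and> [x = v i] (mod int m2)" for i
      using binary_chinese_remainder_int[OF cop] by blast
    then obtain x where x: "\<And>i. [x i = u i] (mod int m1)" "\<And>i. [x i = v i] (mod int m2)" by metis
    define n where "n = reduce r (m1 * m2) x"
    have nx: "[n i = x i] (mod int m1)" "[n i = x i] (mod int m2)" if "i < r" for i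
      using reduce_cong[OF that, of "m1 * m2" x]
      unfolding n_def by (metis cong_dvd_modulus dvd_triv_left dvd_triv_right of_nat_mult)+
    have n: "n \<in> points r {0..<int (m1 * m2)}" unfolding n_def using m by (intro reduce_in_points) auto
    have u': "reduce r m1 n = u"
    proof (rule points_eqI[OF reduce_in_points[OF m(2)] u(1)])
      fix i assume i: "i < r"
      have "n i mod int m1 = u i mod int m1" using nx(1)[OF i] x(1)[of i] by (simp add: cong_def)
      then show "reduce r m1 n i = u i" using points_nth[OF u(1) i] i by (simp add: reduce_def)
    qed
    have v': "reduce r m2 n = v"
    proof (rule points_eqI[OF reduce_in_points[OF m(3)] v(1)])
      fix i assume i: "i < r"
      have "n i mod int m2 = v i mod int m2" using nx(2)[OF i] x(2)[of i] by (simp add: cong_def)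
      then show "reduce r m2 n i = v i" using points_nth[OF v(1) i] i by (simp add: reduce_def)
    qed
    have "Q1 n" "Q2 n"
      using periodic_reduce[OF Q1, of n] periodic_reduce[OF Q2, of n] u v u' v' by auto
    then show "\<exists>n\<in>?A. z = (reduce r m1 n, reduce r m2 n)"
      using n u' v' z by auto
  qed
  then have "card ?A = card ?B" by (rule bij_betw_same_card)
  then show ?thesis by (simp add: card_cartesian_product)
qed

lemma periodic_dvd: "periodic r m Q \<Longrightarrow> m dvd m' \<Longrightarrow> periodic r m' Q"
  unfolding periodic_def by (meson cong_dvd_modulus of_nat_dvd_iff)

lemma periodic_all_prod:
  assumes "finite T" "\<And>p. p \<in> T \<Longrightarrow> periodic r p (Q p)"
  shows "periodic r (\<Prod>T) (\<lambda>n. \<forall>p\<in>T. Q p n)"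
proof -
  have "periodic r (\<Prod>T) (Q p)" if "p \<in> T" for p
  proof (rule periodic_dvd[OF assms(2)[OF that]])
    show "p dvd \<Prod>T" using dvd_prodI[OF assms(1) that, of "\<lambda>p. p"] by simp
  qed
  then show ?thesis unfolding periodic_def by blast
qed

lemma card_points_crt_primes:
  assumes "finite T" "\<And>p. p \<in> T \<Longrightarrow> prime p" "\<And>p. p \<in> T \<Longrightarrow> periodic r p (Q p)"
  shows "card {n \<in> points r {0..<int (\<Prod>T)}. \<forall>p\<in>T. Q p n} =
    (\<Prod>p\<in>T. card {n \<in> points r {0..<int p}. Q p n})"
  using assms
proof (induction T rule: finite_induct)
  case empty
  then show ?case by (simp add: card_points)
next
  case (insert p T)
  have "coprime p (\<Prod>T)"
    using insert by (intro prod_coprime_right primes_coprime) auto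
  moreover have "p > 0" "\<Prod>T > 0"
    using insert.prems(1) by (auto intro!: prod_pos simp: prime_gt_0_nat)
  moreover have "periodic r p (Q p)" using insert by auto
  moreover have "periodic r (\<Prod>T) (\<lambda>n. \<forall>p\<in>T. Q p n)"
    using insert by (intro periodic_all_prod) auto
  ultimately have "card {n \<in> points r {0..<int (p * \<Prod>T)}. Q p n \<and> (\<forall>p\<in>T. Q p n)} =
      card {n \<in> points r {0..<int p}. Q p n} * card {n \<in> points r {0..<int (\<Prod>T)}. \<forall>p\<in>T. Q p n}"
    by (rule card_points_crt)
  then show ?case using insert by simp
qed

text \<open>Coordinatewise division with remainder, \<open>n i = u i * m + v i\<close>, splits the
  large box into \<open>q ^ r\<close> translates of the period box.\<close>

lemma card_points_multiple_period:
  assumes m: "m > 0" and Q: "periodic r m Q"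
  shows "card {n \<in> points r {0..<int (q * m)}. Q n} = q ^ r * card {n \<in> points r {0..<int m}. Q n}"
proof -
  let ?A = "{n \<in> points r {0..<int (q * m)}. Q n}"
  let ?B = "points r {0..<int q} \<times> {n \<in> points r {0..<int m}. Q n}"
  let ?f = "\<lambda>n. (\<lambda>i\<in>{..<r}. n i div int m, reduce r m n)"
  let ?g = "\<lambda>(u, v). \<lambda>i\<in>{..<r}. u i * int m + v i"
  have "bij_betw ?f ?A ?B"
  proof (rule bij_betwI)
    show "?f \<in> ?A \<rightarrow> ?B"
    proof
      fix n assume n: "n \<in> ?A"
      have "n i div int m \<in> {0..<int q}" if "i < r" for i
      proof -
        have "0 \<le> n i" "n i < int q * int m" using n points_nth[of n r _ i] that by fastforce+
        moreover have "n i div int m * int m \<le> n i"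
          using m pos_mod_sign[of "int m" "n i"] by (simp flip: minus_mod_eq_div_mult)
        ultimately have "n i div int m * int m < int q * int m" by linarith
        then show ?thesis using m \<open>0 \<le> n i\<close> by (simp add: pos_imp_zdiv_nonneg_iff)
      qed
      then have "(\<lambda>i\<in>{..<r}. n i div int m) \<in> points r {0..<int q}"
        unfolding points_def by auto
      then show "?f n \<in> ?B" using n m by (simp add: reduce_in_points periodic_reduce[OF Q])
    qed
    show "?g \<in> ?B \<rightarrow> ?A"
    proof (rule Pi_I, clarsimp simp del: of_nat_mult)
      fix u v assume u: "u \<in> points r {0..<int q}" and v: "v \<in> points r {0..<int m}" "Q v"
      let ?n = "\<lambda>i\<in>{..<r}. u i * int m + v i"
      have "u i * int m + v i \<in> {0..<int (q * m)}" if "i < r" for i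
      proof -
        have *: "0 \<le> u i" "u i \<le> int q - 1" "0 \<le> v i" "v i < int m"
          using points_nth[OF u that] points_nth[OF v(1) that] by auto
        then have "u i * int m \<le> (int q - 1) * int m" by (intro mult_right_mono) auto
        then show ?thesis using * by (simp add: algebra_simps)
      qed
      then have "?n \<in> points r {0..<int (q * m)}" unfolding points_def by (auto simp del: of_nat_mult)
      moreover have "Q ?n = Q v" using Q unfolding periodic_def by (auto simp: cong_def)
      ultimately show "?n \<in> points r {0..<int (q * m)} \<and> Q ?n" using v by simp
    qed
    show "?g (?f n) = n" if "n \<in> ?A" for n
    proof (rule points_eqI[of _ r UNIV])
      show "n \<in> points r UNIV" using that by (auto simp: points_def)
    qed (auto simp: points_def reduce_def)
    show "?f (?g z) = z" if z: "z \<in> ?B" for z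
    proof -
      obtain u v where uv: "z = (u, v)" "u \<in> points r {0..<int q}" "v \<in> points r {0..<int m}"
        using z by blast
      have v: "v i div int m = 0" "v i mod int m = v i" if "i < r" for i
        using points_nth[OF uv(3) that] by auto
      have "(\<lambda>i\<in>{..<r}. ?g z i div int m) = u"
        by (rule points_eqI[of _ r UNIV, OF _ uv(2)]) (use m v in \<open>auto simp: uv(1) points_def\<close>)
      moreover have "reduce r m (?g z) = v"
        by (rule points_eqI[of _ r UNIV, OF _ uv(3)]) (use m v in \<open>auto simp: uv(1) points_def reduce_def\<close>)
      ultimately show ?thesis by (simp add: uv(1))
    qed
  qed
  then have "card ?A = card ?B" by (rule bij_betw_same_card)
  then show ?thesis by (simp add: card_cartesian_product card_points)
qed

lemma le_Suc_div_mult: "m > 0 \<Longrightarrow> B \<le> (B div m + 1) * m" for B m :: nat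
  using dividend_less_times_div[of m B] by (simp add: algebra_simps)

lemma LIMSEQ_div_over:
  assumes "m > 0"
  shows "(\<lambda>B. real (B div m) / real B) \<longlonglongrightarrow> 1 / real m"
proof (rule tendsto_sandwich)
  show "(\<lambda>B. 1 / real m - 1 / real B) \<longlonglongrightarrow> 1 / real m"
    using tendsto_diff[OF tendsto_const lim_1_over_n, of "1 / real m"] by simp
  show "\<forall>\<^sub>F B in sequentially. 1 / real m - 1 / real B \<le> real (B div m) / real B"
  proof (rule eventually_sequentiallyI[of 1])
    fix B :: nat assume B: "1 \<le> B"
    have "real B \<le> real ((B div m + 1) * m)" using le_Suc_div_mult[OF assms] by (rule of_nat_mono)
    then have "real B / real m \<le> real (B div m) + 1" using assms by (simp add: divide_le_eq algebra_simps)
    then have "real B / real m - 1 \<le> real (B div m)" by linarith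
    then have "(real B / real m - 1) / real B \<le> real (B div m) / real B" by (rule divide_right_mono) simp
    then show "1 / real m - 1 / real B \<le> real (B div m) / real B"
      using B by (simp add: diff_divide_distrib)
  qed
  show "\<forall>\<^sub>F B in sequentially. real (B div m) / real B \<le> 1 / real m"
  proof (rule eventually_sequentiallyI[of 1])
    fix B :: nat assume B: "1 \<le> B"
    have "real (B div m) / real B \<le> (real B / real m) / real B"
      by (intro divide_right_mono of_nat_div_le_of_nat) simp
    then show "real (B div m) / real B \<le> 1 / real m" using B by simp
  qed
qed simp

text \<open>The count is monotone in \<open>B\<close>, so it lies between the exact counts for the
  neighbouring multiples \<open>(B div m) * m\<close> and \<open>(B div m + 1) * m\<close> of the
  period.\<close>

lemma periodic_density:
  assumes m: "m > 0" and Q: "periodic r m Q"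
  shows "(\<lambda>B. real (card {n \<in> points r {0..<int B}. Q n}) / real B ^ r)
    \<longlonglongrightarrow> real (card {n \<in> points r {0..<int m}. Q n}) / real m ^ r"
proof (rule tendsto_sandwich)
  let ?N = "\<lambda>B. card {n \<in> points r {0..<int B}. Q n}"
  have mono: "?N B \<le> ?N B'" if "B \<le> B'" for B B'
  proof (rule card_mono)
    show "finite {n \<in> points r {0..<int B'}. Q n}" by (auto simp: finite_points)
    have "points r {0..<int B} \<subseteq> points r {0..<int B'}"
      unfolding points_def using that by (intro PiE_mono) auto
    then show "{n \<in> points r {0..<int B}. Q n} \<subseteq> {n \<in> points r {0..<int B'}. Q n}" by auto
  qed
  have lower: "real (B div m) ^ r * real (?N m) \<le> real (?N B)" for B
  proof -
    have "?N (B div m * m) \<le> ?N B" by (rule mono) simp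
    then have "real ((B div m) ^ r * ?N m) \<le> real (?N B)"
      by (simp only: card_points_multiple_period[OF m Q] of_nat_le_iff)
    then show ?thesis by simp
  qed
  have upper: "real (?N B) \<le> (real (B div m) + 1) ^ r * real (?N m)" for B
  proof -
    have "B \<le> (B div m + 1) * m" using m by (rule le_Suc_div_mult)
    then have "?N B \<le> ?N ((B div m + 1) * m)" by (rule mono)
    then have "real (?N B) \<le> real ((B div m + 1) ^ r * ?N m)"
      by (simp only: card_points_multiple_period[OF m Q] of_nat_le_iff)
    then show ?thesis by (simp add: add.commute)
  qed
  show "\<forall>\<^sub>F B in sequentially. (real (B div m) / real B) ^ r * real (?N m) \<le> real (?N B) / real B ^ r"
    using lower by (intro always_eventually allI) (auto simp: power_divide intro: divide_right_mono)
  show "\<forall>\<^sub>F B in sequentially. real (?N B) / real B ^ r \<le> (real (B div m) / real B + 1 / real B) ^ r * real (?N m)"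
    using upper by (intro always_eventually allI) (auto simp: power_divide simp flip: add_divide_distrib intro: divide_right_mono)
  show "(\<lambda>B. (real (B div m) / real B) ^ r * real (?N m)) \<longlonglongrightarrow> real (?N m) / real m ^ r"
    using tendsto_mult[OF tendsto_power[OF LIMSEQ_div_over[OF m], of r] tendsto_const[of "real (?N m)"]]
    by (simp add: power_divide)
  show "(\<lambda>B. (real (B div m) / real B + 1 / real B) ^ r * real (?N m)) \<longlonglongrightarrow> real (?N m) / real m ^ r"
    using tendsto_mult[OF tendsto_power[OF tendsto_add[OF LIMSEQ_div_over[OF m] lim_1_over_n], of r] tendsto_const[of "real (?N m)"]]
    by (simp add: power_divide)
qed

section \<open>Density of the coprime values of a single family\<close>

lemma mpoly_eval_cong_mod:
  fixes a :: "int mpoly"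
  assumes "a \<in> mpolys_in V" "\<And>i. i \<in> V \<Longrightarrow> [n i = n' i] (mod k)"
  shows "[mpoly_eval a n = mpoly_eval a n'] (mod k)"
  unfolding mpoly_eval_def using assms
  by (intro cong_sum cong_mult cong_prod cong_pow cong_refl) (auto simp: mpolys_in_def)

lemma periodic_no_common_zero:
  assumes "F \<subseteq> mpolys_in {..<r}"
  shows "periodic r p (\<lambda>n. \<exists>a\<in>F. \<not> int p dvd mpoly_eval a n)"
proof -
  have "int p dvd mpoly_eval a n \<longleftrightarrow> int p dvd mpoly_eval a n'"
    if "a \<in> F" "\<forall>i<r. [n i = n' i] (mod int p)" for a n n'
    using mpoly_eval_cong_mod[of a "{..<r}" n n' "int p"] that assms by (auto intro!: cong_dvd_iff)
  then show ?thesis unfolding periodic_def by blast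
qed

text \<open>The case that \<open>S\<close> has no nonzero element fits in: then
  \<open>Gcd S = 0\<close>, which every prime divides.\<close>

lemma Gcd_int_eq_1_iff:
  fixes S :: "int set"
  shows "Gcd S = 1 \<longleftrightarrow> (\<forall>p. prime p \<longrightarrow> (\<exists>x\<in>S. \<not> int p dvd x))"
proof
  assume "Gcd S = 1"
  then have "\<not> int p dvd Gcd S" if "prime p" for p
    using that by (auto simp: prime_gt_Suc_0_nat dest: prime_gt_1_nat)
  then show "\<forall>p. prime p \<longrightarrow> (\<exists>x\<in>S. \<not> int p dvd x)"
    by (simp add: dvd_Gcd_iff)
next
  assume *: "\<forall>p. prime p \<longrightarrow> (\<exists>x\<in>S. \<not> int p dvd x)"
  show "Gcd S = 1"
  proof (rule ccontr)
    assume "Gcd S \<noteq> 1"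
    then have "nat (Gcd S) \<noteq> 1" by (metis Gcd_int_greater_eq_0 nat_eq_iff2 int_nat_eq of_nat_1)
    then obtain p where p: "prime p" "p dvd nat (Gcd S)" using prime_factor_nat by blast
    then have "int p dvd Gcd S" by (simp add: int_dvd_int_iff[symmetric] Gcd_int_greater_eq_0 del: int_dvd_int_iff)
    then have "\<forall>x\<in>S. int p dvd x" by (simp add: dvd_Gcd_iff)
    then show False using * p(1) by blast
  qed
qed

lemma coprime_values_iff:
  "n \<in> coprime_values r F \<longleftrightarrow>
    n \<in> points r UNIV \<and> (\<forall>p. prime p \<longrightarrow> (\<exists>a\<in>F. \<not> int p dvd mpoly_eval a n))"
  by (simp add: coprime_values_def Gcd_int_eq_1_iff)

lemma num_common_zeros_mod_le: "num_common_zeros_mod r F p \<le> p ^ r"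
proof -
  have "num_common_zeros_mod r F p \<le> card (points r {0..<int p})"
    unfolding num_common_zeros_mod_def by (intro card_mono) (auto simp: finite_points)
  then show ?thesis by (simp add: card_points)
qed

lemma card_no_common_zero:
  "real (card {n \<in> points r {0..<int p}. \<exists>a\<in>F. \<not> int p dvd mpoly_eval a n}) =
    real p ^ r - real (num_common_zeros_mod r F p)"
proof -
  let ?Z = "{n \<in> points r {0..<int p}. \<forall>Q\<in>F. mpoly_eval Q n mod int p = 0}"
  have "{n \<in> points r {0..<int p}. \<exists>a\<in>F. \<not> int p dvd mpoly_eval a n} = points r {0..<int p} - ?Z"
    by (auto simp: dvd_eq_mod_eq_0)
  moreover have "card (points r {0..<int p} - ?Z) = card (points r {0..<int p}) - card ?Z"
    by (intro card_Diff_subset) (auto simp: finite_points)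
  ultimately show ?thesis
    using num_common_zeros_mod_le[of r F p] by (simp add: card_points num_common_zeros_mod_def of_nat_diff)
qed

lemma coprime_for_small_primes_density:
  assumes "F \<subseteq> mpolys_in {..<r}"
  shows "(\<lambda>B. real (card {n \<in> points r {0..<int B}. \<forall>p\<in>{p. prime p \<and> p \<le> M}. \<exists>a\<in>F. \<not> int p dvd mpoly_eval a n}) / real B ^ r)
    \<longlonglongrightarrow> (\<Prod>p | prime p \<and> p \<le> M. (1 - real (num_common_zeros_mod r F p) / real p ^ r))"
proof -
  let ?T = "{p. prime p \<and> p \<le> M}"
  let ?Q = "\<lambda>p n. \<exists>a\<in>F. \<not> int p dvd mpoly_eval a n"
  have T: "finite ?T" by (rule finite_subset[of _ "{..M}"]) auto
  have pos: "\<Prod>?T > 0" by (intro prod_pos) (auto simp: prime_gt_0_nat)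
  have "real (card {n \<in> points r {0..<int (\<Prod>?T)}. \<forall>p\<in>?T. ?Q p n}) / real (\<Prod>?T) ^ r =
    (\<Prod>p\<in>?T. real (card {n \<in> points r {0..<int p}. ?Q p n})) / (\<Prod>p\<in>?T. real p ^ r)"
    by (subst card_points_crt_primes[OF T]) (auto simp: periodic_no_common_zero[OF assms] prod_power_distrib)
  also have "\<dots> = (\<Prod>p\<in>?T. (real p ^ r - real (num_common_zeros_mod r F p)) / real p ^ r)"
    by (simp add: card_no_common_zero prod_dividef)
  also have "\<dots> = (\<Prod>p\<in>?T. 1 - real (num_common_zeros_mod r F p) / real p ^ r)"
    by (intro prod.cong) (auto simp: diff_divide_distrib prime_gt_0_nat)
  finally show ?thesis
    using periodic_density[OF pos periodic_all_prod[OF T], of r ?Q] periodic_no_common_zero[OF assms] by simp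
qed

text \<open>The factors lie in the unit interval, so the partial products decrease and are bounded
  below by \<open>0\<close>; the limit \<open>0\<close> is not excluded.\<close>

lemma partial_products_convergent:
  fixes f :: "nat \<Rightarrow> real"
  assumes "\<And>p. prime p \<Longrightarrow> 0 \<le> f p \<and> f p \<le> 1"
  obtains \<mu> where "(\<lambda>M. \<Prod>p | prime p \<and> p \<le> M. f p) \<longlonglongrightarrow> \<mu>"
proof -
  let ?X = "\<lambda>M::nat. \<Prod>p | prime p \<and> p \<le> M. f p"
  have nonneg: "0 \<le> ?X M" for M by (intro prod_nonneg) (use assms in auto)
  have "decseq ?X"
  proof (rule decseq_SucI)
    fix M :: nat
    have fin: "finite {p. prime p \<and> p \<le> M}" by (rule finite_subset[of _ "{..M}"]) auto
    show "?X (Suc M) \<le> ?X M"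
    proof (cases "prime (Suc M)")
      case True
      then have "{p. prime p \<and> p \<le> Suc M} = insert (Suc M) {p. prime p \<and> p \<le> M}" by (auto simp: le_Suc_eq)
      then have "?X (Suc M) = f (Suc M) * ?X M" using fin by simp
      also have "\<dots> \<le> 1 * ?X M" using assms[OF True] nonneg by (intro mult_right_mono) auto
      finally show ?thesis by simp
    next
      case False
      then have "{p. prime p \<and> p \<le> Suc M} = {p. prime p \<and> p \<le> M}" by (auto simp: le_Suc_eq)
      then show ?thesis by simp
    qed
  qed
  then obtain \<mu> where "?X \<longlonglongrightarrow> \<mu>" by (rule decseq_convergent) (use nonneg in auto)
  then show ?thesis by (rule that)
qed

theorem coprime_values_density:
  fixes F :: "int mpoly set"
  assumes F: "finite F" "F \<subseteq> mpolys_in {..<r}" "\<not> F \<subseteq> {0}" "coprime_family r F"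
  obtains \<mu> where
    "(\<lambda>M. \<Prod>p | prime p \<and> p \<le> M. (1 - real (num_common_zeros_mod r F p) / real p ^ r)) \<longlonglongrightarrow> \<mu>"
    "has_density r (coprime_values r F) \<mu>"
proof -
  let ?X = "\<lambda>M. \<Prod>p | prime p \<and> p \<le> M. (1 - real (num_common_zeros_mod r F p) / real p ^ r)"
  have "0 \<le> 1 - real (num_common_zeros_mod r F p) / real p ^ r \<and>
      1 - real (num_common_zeros_mod r F p) / real p ^ r \<le> 1" if "prime p" for p
    using num_common_zeros_mod_le[of r F p] prime_gt_0_nat[OF that]
    by (auto simp: divide_le_eq_1 simp flip: of_nat_power)
  then obtain \<mu> where \<mu>: "?X \<longlonglongrightarrow> \<mu>"
    using partial_products_convergent[of "\<lambda>p. 1 - real (num_common_zeros_mod r F p) / real p ^ r"] by blast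
  obtain C :: real and M\<^sub>0 where C: "C \<ge> 0" and tail: "\<And>M B. M \<ge> M\<^sub>0 \<Longrightarrow> B \<ge> 1 \<Longrightarrow>
      real (card (bad_points r F M B)) \<le> C * real B ^ r * (1 / real M + 1 / real B)"
    using tail_bound[OF F] by blast
  let ?N = "\<lambda>B. real (card (coprime_values r F \<inter> points r {0..<int B}))"
  let ?S = "\<lambda>M B. {n \<in> points r {0..<int B}. \<forall>p\<in>{p. prime p \<and> p \<le> M}. \<exists>a\<in>F. \<not> int p dvd mpoly_eval a n}"
  let ?A = "\<lambda>M B. real (card (?S M B))"
  have upper: "?N B \<le> ?A M B" for M B
    by (intro of_nat_mono card_mono) (auto simp: finite_points coprime_values_iff)
  have lower: "?A M B \<le> ?N B + real (card (bad_points r F M B))" for M B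
  proof -
    have "?S M B \<subseteq> (coprime_values r F \<inter> points r {0..<int B}) \<union> bad_points r F M B"
    proof
      fix n assume n: "n \<in> ?S M B"
      have "n \<in> points r UNIV" using n by (auto simp: points_def)
      then show "n \<in> (coprime_values r F \<inter> points r {0..<int B}) \<union> bad_points r F M B"
        using n by (auto simp: coprime_values_iff bad_points_def) (meson not_le)
    qed
    then have "card (?S M B) \<le> card ((coprime_values r F \<inter> points r {0..<int B}) \<union> bad_points r F M B)"
      by (intro card_mono) (auto simp: finite_points bad_points_def)
    also have "\<dots> \<le> card (coprime_values r F \<inter> points r {0..<int B}) + card (bad_points r F M B)"
      by (rule card_Un_le)
    finally show ?thesis by (simp flip: of_nat_add)
  qed
  have "(\<lambda>B. ?N B / real B ^ r) \<longlonglongrightarrow> \<mu>"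
  proof (rule tendstoI)
    fix \<epsilon> :: real assume \<epsilon>: "\<epsilon> > 0"
    have lim_C: "(\<lambda>k. C * (1 / real k)) \<longlonglongrightarrow> 0"
      using tendsto_mult_right_zero[OF lim_1_over_n, of C] by simp
    have small: "\<forall>\<^sub>F k in sequentially. C * (1 / real k) < \<epsilon> / 4"
      using order_tendstoD(2)[OF lim_C, of "\<epsilon> / 4"] \<epsilon> by simp
    \<comment> \<open>\<open>M\<close> is fixed before \<open>B\<close>. The budget is
      \<open>\<epsilon> / 4\<close> each for the partial product, for the density at fixed
      \<open>M\<close>, and for the tail terms \<open>C / M\<close> and \<open>C / B\<close>;
      \<open>small\<close> serves for both of the latter.\<close>
    have "\<forall>\<^sub>F M in sequentially. dist (?X M) \<mu> < \<epsilon> / 4 \<and> C * (1 / real M) < \<epsilon> / 4 \<and> M \<ge> M\<^sub>0"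
      using tendstoD[OF \<mu>, of "\<epsilon> / 4"] small eventually_ge_at_top[of M\<^sub>0] \<epsilon> by (simp add: eventually_conj)
    then obtain M where M: "dist (?X M) \<mu> < \<epsilon> / 4" "C * (1 / real M) < \<epsilon> / 4" "M \<ge> M\<^sub>0"
      using eventually_happens[of _ sequentially] by auto
    have "\<forall>\<^sub>F B in sequentially. dist (?A M B / real B ^ r) (?X M) < \<epsilon> / 4"
      using tendstoD[OF coprime_for_small_primes_density[OF F(2), of M], of "\<epsilon> / 4"] \<epsilon> by simp
    with small eventually_ge_at_top[of 1]
    show "\<forall>\<^sub>F B in sequentially. dist (?N B / real B ^ r) \<mu> < \<epsilon>"
    proof eventually_elim
      case (elim B)
      have pos: "real B ^ r > 0" using elim by simp
      have "real (card (bad_points r F M B)) / real B ^ r \<le> C * real B ^ r * (1 / real M + 1 / real B) / real B ^ r"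
        using tail[OF M(3), of B] elim by (intro divide_right_mono) auto
      also have "\<dots> = C * (1 / real M) + C * (1 / real B)" using pos by (simp add: field_simps)
      finally have bad: "real (card (bad_points r F M B)) / real B ^ r < \<epsilon> / 2"
        using M(2) elim by linarith
      have "?A M B / real B ^ r \<le> ?N B / real B ^ r + real (card (bad_points r F M B)) / real B ^ r"
        using lower[where M = M and B = B] pos by (simp add: divide_right_mono flip: add_divide_distrib)
      moreover have "?N B / real B ^ r \<le> ?A M B / real B ^ r"
        using upper by (intro divide_right_mono) auto
      ultimately show ?case
        using bad M(1) elim unfolding dist_real_def by linarith
    qed
  qed
  then have "has_density r (coprime_values r F) \<mu>"
    by (simp add: has_density_def card_points)
  then show ?thesis using that \<mu> by blast
qed

section \<open>Families of products and the four assertions\<close>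

lemma finite_product_family:
  assumes "\<And>j. j \<in> {1..l} \<Longrightarrow> finite (F j)"
  shows "finite (product_family l F)"
proof -
  \<comment> \<open>The choice functions in \<open>product_family\<close> are arbitrary off
    \<open>{1..l}\<close>; restricting them leaves the product unchanged and only finitely many
    functions.\<close>
  have "product_family l F \<subseteq> (\<lambda>A. \<Prod>j = 1..l. A j) ` (\<Pi>\<^sub>E j\<in>{1..l}. F j)"
  proof
    fix a assume "a \<in> product_family l F"
    then obtain A where A: "\<forall>j\<in>{1..l}. A j \<in> F j" "a = (\<Prod>j = 1..l. A j)"
      unfolding product_family_def by blast
    then have "a = (\<Prod>j = 1..l. restrict A {1..l} j)" by (auto intro: prod.cong)
    moreover have "restrict A {1..l} \<in> (\<Pi>\<^sub>E j\<in>{1..l}. F j)" using A by auto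
    ultimately show "a \<in> (\<lambda>A. \<Prod>j = 1..l. A j) ` (\<Pi>\<^sub>E j\<in>{1..l}. F j)" by blast
  qed
  then show ?thesis by (rule finite_subset) (intro finite_imageI finite_PiE, use assms in auto)
qed

text \<open>For the direction from products to one family, choose by contradiction in each family a
  member whose value is not divisible by \<open>p\<close>; the product of these choices is not
  divisible by \<open>p\<close> either.\<close>

lemma prime_dvd_product_family_iff:
  assumes "prime p"
  shows "(\<forall>a\<in>product_family l F. int p dvd mpoly_eval a n) \<longleftrightarrow>
    (\<exists>j\<in>{1..l}. \<forall>a\<in>F j. int p dvd mpoly_eval a n)"
proof
  assume L: "\<forall>a\<in>product_family l F. int p dvd mpoly_eval a n"
  show "\<exists>j\<in>{1..l}. \<forall>a\<in>F j. int p dvd mpoly_eval a n"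
  proof (rule ccontr)
    assume "\<not> ?thesis"
    then have "\<forall>j\<in>{1..l}. \<exists>a. a \<in> F j \<and> \<not> int p dvd mpoly_eval a n" by blast
    then obtain A where A: "\<And>j. j \<in> {1..l} \<Longrightarrow> A j \<in> F j \<and> \<not> int p dvd mpoly_eval (A j) n"
      by metis
    then have "(\<Prod>j = 1..l. A j) \<in> product_family l F" unfolding product_family_def by blast
    with L have "int p dvd (\<Prod>j = 1..l. mpoly_eval (A j) n)"
      by (simp flip: ring_hom_prod[OF ring_hom_mpoly_eval])
    then obtain j where "j \<in> {1..l}" "int p dvd mpoly_eval (A j) n"
      using assms by (auto simp: prime_dvd_prod_iff)
    then show False using A by blast
  qed
next
  assume "\<exists>j\<in>{1..l}. \<forall>a\<in>F j. int p dvd mpoly_eval a n"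
  then obtain j where j: "j \<in> {1..l}" "\<forall>a\<in>F j. int p dvd mpoly_eval a n" by blast
  show "\<forall>a\<in>product_family l F. int p dvd mpoly_eval a n"
  proof
    fix a assume "a \<in> product_family l F"
    then obtain A where A: "\<forall>j\<in>{1..l}. A j \<in> F j" "a = (\<Prod>j = 1..l. A j)"
      unfolding product_family_def by blast
    have "mpoly_eval (A j) n dvd (\<Prod>j = 1..l. mpoly_eval (A j) n)"
      using j(1) by (intro dvd_prodI) auto
    moreover have "int p dvd mpoly_eval (A j) n" using A j by blast
    ultimately show "int p dvd mpoly_eval a n"
      unfolding A(2) ring_hom_prod[OF ring_hom_mpoly_eval] by (rule dvd_trans[rotated])
  qed
qed

lemma prime_elem_dvd_prod:
  assumes "prime_elem p" "finite S" "p dvd prod f S"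
  shows "\<exists>x\<in>S. p dvd f x"
  using assms(2,3)
proof (induction S rule: finite_induct)
  case empty
  then show ?case using assms(1) by (simp add: prime_elem_def)
next
  case (insert x S)
  then show ?case using assms(1) by (auto simp: prime_elem_dvd_mult_iff)
qed

text \<open>The choice argument of \<open>prime_dvd_product_family_iff\<close>, now with an
  irreducible factor \<open>q\<close> of \<open>d\<close>, which is not constant and so fails to
  divide some member of every family. Passing to \<open>q\<close> matters: the factors of a
  composite \<open>d\<close> could be spread over several families.\<close>

lemma coprime_product_family:
  assumes F: "\<And>j. j \<in> {1..l} \<Longrightarrow> F j \<subseteq> mpolys_in {..<r}" "\<And>j. j \<in> {1..l} \<Longrightarrow> coprime_family r (F j)"
    and nz: "a \<in> product_family l F" "a \<noteq> 0"
  shows "coprime_family r (product_family l F)"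
proof (rule coprime_familyI)
  fix d :: "rat mpoly"
  assume d: "d \<in> mpolys_in {..<r}" and dvd: "\<And>a. a \<in> product_family l F \<Longrightarrow> d dvd rat_mpoly a"
  have d0: "d \<noteq> 0" using dvd[OF nz(1)] nz(2) by auto
  show "d \<in> mpolys_in {}"
  proof (rule ccontr)
    assume "d \<notin> mpolys_in {}"
    then have "\<not> d dvd 1" by (simp add: is_unit_mpoly_iff)
    then obtain q where q: "irreducible q" "q dvd d" using irreducible_divisor_exists d0 by blast
    have "q \<in> mpolys_in {..<r}" using mpolys_in_dvd[OF q(2) d0 d] .
    moreover have "q \<notin> mpolys_in {}" using q(1) is_unit_mpoly_iff[of q] by (auto simp: irreducible_def)
    ultimately have "\<exists>a. a \<in> F j \<and> \<not> q dvd rat_mpoly a" if "j \<in> {1..l}" for j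
      using coprime_family_dvd[OF F(2)[OF that] F(1)[OF that], of q] by blast
    then obtain A where A: "\<And>j. j \<in> {1..l} \<Longrightarrow> A j \<in> F j \<and> \<not> q dvd rat_mpoly (A j)" by metis
    then have "(\<Prod>j = 1..l. A j) \<in> product_family l F" unfolding product_family_def by blast
    then have "q dvd rat_mpoly (\<Prod>j = 1..l. A j)" using dvd q(2) dvd_trans by blast
    then have "\<exists>j\<in>{1..l}. q dvd rat_mpoly (A j)"
      unfolding ring_hom_prod[OF ring_hom_rat_mpoly]
      by (intro prime_elem_dvd_prod irreducible_imp_prime_elem_mpoly q(1)) auto
    then show False using A by blast
  qed
qed

text \<open>A set of zeros as large as the finite box is the whole box, and periodicity carries the
  vanishing from the box to all integer points.\<close>

lemma num_common_zeros_mod_full_iff: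
  assumes "F \<subseteq> mpolys_in {..<r}" "p > 0"
  shows "num_common_zeros_mod r F p = p ^ r \<longleftrightarrow> (\<forall>n\<in>points r UNIV. \<forall>a\<in>F. int p dvd mpoly_eval a n)"
proof -
  let ?B = "points r {0..<int p}"
  let ?Z = "{n \<in> ?B. \<forall>Q\<in>F. mpoly_eval Q n mod int p = 0}"
  have "num_common_zeros_mod r F p = p ^ r \<longleftrightarrow> card ?Z = card ?B"
    by (simp add: num_common_zeros_mod_def card_points)
  also have "\<dots> \<longleftrightarrow> ?Z = ?B"
    using card_subset_eq[of ?B ?Z] by (auto simp: finite_points)
  also have "\<dots> \<longleftrightarrow> (\<forall>n\<in>?B. \<forall>a\<in>F. int p dvd mpoly_eval a n)"
    by (auto simp: dvd_eq_mod_eq_0)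
  also have "\<dots> \<longleftrightarrow> (\<forall>n\<in>points r UNIV. \<forall>a\<in>F. int p dvd mpoly_eval a n)"
  proof
    assume B: "\<forall>n\<in>?B. \<forall>a\<in>F. int p dvd mpoly_eval a n"
    show "\<forall>n\<in>points r UNIV. \<forall>a\<in>F. int p dvd mpoly_eval a n"
      using B periodic_reduce[OF periodic_no_common_zero[OF assms(1), of p]] reduce_in_points[OF assms(2)]
      by blast
  next
    have "?B \<subseteq> points r UNIV" by (auto simp: points_def)
    then show "\<forall>n\<in>points r UNIV. \<forall>a\<in>F. int p dvd mpoly_eval a n \<Longrightarrow> \<forall>n\<in>?B. \<forall>a\<in>F. int p dvd mpoly_eval a n"
      by blast
  qed
  finally show ?thesis .
qed

theorem proposition6p3:
  fixes r l :: nat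
    and s :: "nat \<Rightarrow> nat"
    and P :: "nat \<Rightarrow> nat \<Rightarrow> int mpoly"
    and Fam :: "nat \<Rightarrow> int mpoly set"
    and Prods :: "int mpoly set"
    and R :: "(nat \<Rightarrow> int) set"
    and c :: "nat \<Rightarrow> nat"
  assumes "r \<ge> 1"
    and "l \<ge> 1"
    and "\<And>j. j \<in> {1..l} \<Longrightarrow> s j \<ge> 2"
    and "\<And>j i. j \<in> {1..l} \<Longrightarrow> i \<in> {1..s j} \<Longrightarrow> P j i \<in> mpolys r"
    and "\<And>j i. j \<in> {1..l} \<Longrightarrow> i \<in> {1..s j} \<Longrightarrow> P j i \<noteq> 0"
    and Fam: "\<And>j. Fam j = {P j i | i. i \<in> {1..s j}}"
    and "\<And>j. j \<in> {1..l} \<Longrightarrow> coprime_family r (Fam j)"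
    and R: "R = (\<Inter>j \<in> {1..l}. coprime_values r (Fam j))"
    and Prods: "Prods = product_family l Fam"
    and c: "\<And>p. c p = num_common_zeros_mod r Prods p"
  shows "(0 \<notin> Prods \<and> Prods \<subseteq> mpolys r \<and> coprime_family r Prods)
    \<and> R = coprime_values r Prods
    \<and> (\<exists>\<mu>. (\<lambda>M::nat. \<Prod>p | prime p \<and> p \<le> M. (1 - real (c p) / real p ^ r)) \<longlonglongrightarrow> \<mu>
           \<and> has_density r R \<mu>)
    \<and> (\<forall>p. prime p \<longrightarrow> (c p = p ^ r \<longleftrightarrow>
           (\<forall>n \<in> points r UNIV. \<exists>j \<in> {1..l}. \<forall>i \<in> {1..s j}.
              int p dvd mpoly_eval (P j i) n)))"
proof -
  note l = assms(2) and s = assms(3) and P_in = assms(4) and P_nz = assms(5) and coprime = assms(7)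
  have Fam_in: "Fam j \<subseteq> mpolys_in {..<r}" if "j \<in> {1..l}" for j
    using P_in[OF that] by (auto simp: Fam mpolys_eq)
  have Fam_fin: "finite (Fam j)" for j
    by (simp add: Fam)
  have Fam_nz: "0 \<notin> Fam j" if "j \<in> {1..l}" for j
    using P_nz[OF that] by (auto simp: Fam)
  have Prods_in: "Prods \<subseteq> mpolys_in {..<r}"
    unfolding Prods product_family_def using subsetD[OF Fam_in] by (auto intro!: mpolys_in_prod)
  have Prods_nz: "0 \<notin> Prods"
  proof
    assume "0 \<in> Prods"
    then obtain A where A: "\<forall>j\<in>{1..l}. A j \<in> Fam j" "0 = (\<Prod>j = 1..l. A j)"
      unfolding Prods product_family_def by blast
    then obtain j where "j \<in> {1..l}" "A j = 0" by (metis prod_zero_iff finite_atLeastAtMost)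
    then show False using A(1) Fam_nz by metis
  qed
  have fin: "finite Prods"
    unfolding Prods by (rule finite_product_family) (rule Fam_fin)
  have "P j 1 \<in> Fam j" if "j \<in> {1..l}" for j
    using s[OF that] by (auto simp: Fam intro!: exI[of _ 1])
  \<comment> \<open>The product of the first members shows that \<open>Prods\<close> is nonempty and
    hence, as \<open>0\<close> is not in it, contains a nonzero polynomial.\<close>
  then have mem: "(\<Prod>j = 1..l. P j 1) \<in> Prods"
    unfolding Prods product_family_def by blast
  then have coprime_Prods: "coprime_family r Prods"
    unfolding Prods using Prods_nz Fam_in coprime Prods by (intro coprime_product_family) auto
  have dvd_iff: "(\<forall>a\<in>Prods. int p dvd mpoly_eval a n) \<longleftrightarrow>
      (\<exists>j\<in>{1..l}. \<forall>a\<in>Fam j. int p dvd mpoly_eval a n)" if "prime p" for p n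
    unfolding Prods using that by (rule prime_dvd_product_family_iff)
  have R_eq: "R = coprime_values r Prods"
  proof (intro set_eqI)
    fix n
    \<comment> \<open>\<open>l \<ge> 1\<close> makes the index set of the intersection nonempty, so
      that elements of \<open>R\<close> are points.\<close>
    have "n \<in> R \<longleftrightarrow> n \<in> points r UNIV \<and> (\<forall>j\<in>{1..l}. \<forall>p. prime p \<longrightarrow> (\<exists>a\<in>Fam j. \<not> int p dvd mpoly_eval a n))"
      unfolding R using l by (auto simp: coprime_values_iff)
    also have "\<dots> \<longleftrightarrow> n \<in> points r UNIV \<and> (\<forall>p. prime p \<longrightarrow> (\<exists>a\<in>Prods. \<not> int p dvd mpoly_eval a n))"
      using dvd_iff[of _ n] by blast
    finally show "n \<in> R \<longleftrightarrow> n \<in> coprime_values r Prods" by (simp add: coprime_values_iff)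
  qed
  have nontrivial: "\<not> Prods \<subseteq> {0}"
  proof
    assume "Prods \<subseteq> {0}"
    then show False using mem Prods_nz by (metis subsetD singletonD)
  qed
  have density: "\<exists>\<mu>. (\<lambda>M::nat. \<Prod>p | prime p \<and> p \<le> M. (1 - real (c p) / real p ^ r)) \<longlonglongrightarrow> \<mu>
      \<and> has_density r R \<mu>"
  proof (rule coprime_values_density[OF fin Prods_in nontrivial coprime_Prods])
    fix \<mu>
    assume "(\<lambda>M::nat. \<Prod>p | prime p \<and> p \<le> M. (1 - real (num_common_zeros_mod r Prods p) / real p ^ r)) \<longlonglongrightarrow> \<mu>"
      and "has_density r (coprime_values r Prods) \<mu>"
    then show ?thesis unfolding c R_eq by blast
  qed
  have full: "c p = p ^ r \<longleftrightarrow> (\<forall>n\<in>points r UNIV. \<exists>j\<in>{1..l}. \<forall>i\<in>{1..s j}. int p dvd mpoly_eval (P j i) n)"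
    if p: "prime p" for p
  proof -
    have "(\<forall>a\<in>Fam j. int p dvd mpoly_eval a n) \<longleftrightarrow> (\<forall>i\<in>{1..s j}. int p dvd mpoly_eval (P j i) n)" for j n
      unfolding Fam by blast
    then show ?thesis
      unfolding c num_common_zeros_mod_full_iff[OF Prods_in prime_gt_0_nat[OF p]] dvd_iff[OF p] by simp
  qed
  show ?thesis
    using Prods_nz Prods_in coprime_Prods R_eq density full unfolding mpolys_eq by simp
qed

end
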